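(* Let $\Gamma$ be a Coxeter graph with finite vertex set $S$ and let $(A,\Sigma)$ be its Artin–Tits system. Assume that $A$ has a solution to the word problem. Then there exists an algorithm which, given $\alpha\in A$, a word $\omega\in(\Sigma\sqcup\Sigma^{-1})^*$ which represents $\alpha$, and $T\subset S$, decides whether $\alpha\in A_T$ and, if yes, determines a word $\kappa_T(\omega)\in(\Sigma_T\sqcup\Sigma_T^{-1})^*$ which represents $\alpha$.
   Context: A Coxeter graph $\Gamma$ with finite vertex set $S$ encodes a Coxeter matrix $(m_{s,t})_{s,t\in S}$, with $m_{s,s}=1$, $m_{s,t}=m_{t,s}\in\{2,3,\dots,\infty\}$ for $s\ne t$ (edge if $m_{s,t}\ge3$, labeled by $m_{s,t}$ if $m_{s,t}\geq 4$). Let $\mathrm{prod}(a,b:m)$ be the alternating word $aba\cdots$ of length $m$. The Artin–Tits system of $\Gamma$ is $(A,\Sigma)$ with $\Sigma=\{\sigma_s: s\in S\}$ and $A=\langle\Sigma\mid \mathrm{prod}(\sigma_s,\sigma_t:m_{s,t})=\mathrm{prod}(\sigma_t,\sigma_s:m_{s,t}),\ s\ne t,\ m_{s,t}\ne\infty\rangle$. For $T\subset S$, $\Sigma_T=\{\sigma_s:s\in T\}$ and $A_T$ is the subgroup of $A$ generated by $\Sigma_T$. $(\Sigma\sqcup\Sigma^{-1})^*$ is the set of words in the generators and their formal inverses. A solution to the word problem in $A$ is an algorithm which decides whether a given word in $(\Sigma\sqcup\Sigma^{-1})^*$ represents $1\in A$. The element $\alpha$ is given to the algorithm through the word $\omega$.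 *)

theory Defs
  imports
    "HOL-Algebra.Generated_Groups"
    "HOL-Library.Nat_Bijection"
    "HOL-Library.Extended_Nat"
begin

section \<open>Computability\<close>

text \<open>
  The total recursive functions of arity \<open>n\<close>, as functions on argument lists of length \<open>n\<close>:
  the closure of the initial functions under composition, primitive recursion and minimisation
  of regular functions. Values on lists of the wrong length carry no meaning, hence the rule
  \<open>ext\<close>.
\<close>

inductive recursive :: "nat \<Rightarrow> (nat list \<Rightarrow> nat) \<Rightarrow> bool" where
  zero: "recursive n (\<lambda>xs. 0)"
| succ: "recursive 1 (\<lambda>xs. Suc (xs ! 0))"
| proj: "i < n \<Longrightarrow> recursive n (\<lambda>xs. xs ! i)"
| comp: "recursive (length gs) f \<Longrightarrow> (\<forall>g\<in>set gs. recursive n g) \<Longrightarrow>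
    recursive n (\<lambda>xs. f (map (\<lambda>g. g xs) gs))"
| prim_rec: "recursive n f \<Longrightarrow> recursive (n + 2) g \<Longrightarrow>
    recursive (n + 1) (\<lambda>xs. rec_nat (f (tl xs)) (\<lambda>k r. g (k # r # tl xs)) (hd xs))"
| minim: "recursive (n + 1) f \<Longrightarrow> (\<forall>xs. length xs = n \<longrightarrow> (\<exists>y. f (y # xs) = 0)) \<Longrightarrow>
    recursive n (\<lambda>xs. LEAST y. f (y # xs) = 0)"
| ext: "recursive n f \<Longrightarrow> (\<forall>xs. length xs = n \<longrightarrow> f xs = g xs) \<Longrightarrow> recursive n g"

text \<open>
  \<open>F\<close> is computable on the inputs in \<open>X\<close>, where inputs and outputs are presented to the
  algorithm through the codings \<open>enc_in\<close> and \<open>enc_out\<close>. Nothing is required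
  on numbers that do not code an element of \<open>X\<close>.
\<close>

definition computable_on ::
    "('x \<Rightarrow> nat) \<Rightarrow> 'x set \<Rightarrow> ('y \<Rightarrow> nat) \<Rightarrow> ('x \<Rightarrow> 'y) \<Rightarrow> bool" where
  "computable_on enc_in X enc_out F \<longleftrightarrow>
     (\<exists>f. recursive 1 f \<and> (\<forall>x\<in>X. f [enc_in x] = enc_out (F x)))"

definition decidable_on :: "('x \<Rightarrow> nat) \<Rightarrow> 'x set \<Rightarrow> ('x \<Rightarrow> bool) \<Rightarrow> bool" where
  "decidable_on enc X P \<longleftrightarrow> computable_on enc X of_bool P"


section \<open>Words and presented groups\<close>

text \<open>
  A word in the generators and their formal inverses; the letter \<open>(s, True)\<close> is the
  generator with index \<open>s\<close> and \<open>(s, False)\<close> is its formal inverse.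
\<close>

type_synonym 'a word = "('a \<times> bool) list"

definition words :: "'a set \<Rightarrow> 'a word set" where
  "words X = lists (X \<times> UNIV)"

inductive_set pres_cong :: "'a set \<Rightarrow> ('a word \<times> 'a word) set \<Rightarrow> ('a word \<times> 'a word) set"
  for X :: "'a set" and R :: "('a word \<times> 'a word) set" where
  cancel: "s \<in> X \<Longrightarrow> ([(s, b), (s, \<not> b)], []) \<in> pres_cong X R"
| rel: "(l, r) \<in> R \<Longrightarrow> l \<in> words X \<Longrightarrow> r \<in> words X \<Longrightarrow> (l, r) \<in> pres_cong X R"
| refl: "w \<in> words X \<Longrightarrow> (w, w) \<in> pres_cong X R"
| sym: "(u, v) \<in> pres_cong X R \<Longrightarrow> (v, u) \<in> pres_cong X R"
| trans: "(u, v) \<in> pres_cong X R \<Longrightarrow> (v, w) \<in> pres_cong X R \<Longrightarrow> (u, w) \<in> pres_cong X R"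
| app: "(u, u') \<in> pres_cong X R \<Longrightarrow> (v, v') \<in> pres_cong X R \<Longrightarrow> (u @ v, u' @ v') \<in> pres_cong X R"

text \<open>The group with generating set \<open>X\<close> and relations \<open>l = r\<close> for \<open>(l, r) \<in> R\<close>.\<close>

definition presented_group :: "'a set \<Rightarrow> ('a word \<times> 'a word) set \<Rightarrow> 'a word set monoid" where
  "presented_group X R =
     \<lparr>carrier = words X // pres_cong X R,
      mult = (\<lambda>a b. \<Union>u\<in>a. \<Union>v\<in>b. pres_cong X R `` {u @ v}),
      one = pres_cong X R `` {[]}\<rparr>"

fun word_value :: "('g, 'm) monoid_scheme \<Rightarrow> ('a \<Rightarrow> 'g) \<Rightarrow> 'a word \<Rightarrow> 'g" where
  "word_value G \<sigma> [] = \<one>\<^bsub>G\<^esub>"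
| "word_value G \<sigma> ((s, b) # w) = (if b then \<sigma> s else inv\<^bsub>G\<^esub> (\<sigma> s)) \<otimes>\<^bsub>G\<^esub> word_value G \<sigma> w"

lemma pres_cong_words:
  assumes "(u, v) \<in> pres_cong X R"
  shows "u \<in> words X \<and> v \<in> words X"
  using assms by induction (auto simp: words_def)

lemma equiv_pres_cong: "equiv (words X) (pres_cong X R)"
proof (rule equivI)
  show "pres_cong X R \<subseteq> words X \<times> words X" using pres_cong_words by fast
  show "refl_on (words X) (pres_cong X R)" by (rule refl_onI) (rule pres_cong.refl)
  show "sym (pres_cong X R)" by (rule symI) (rule pres_cong.sym)
  show "trans (pres_cong X R)" by (rule transI) (rule pres_cong.trans)
qed

lemma presented_group_mult:
  assumes "u \<in> words X" "v \<in> words X"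
  shows "pres_cong X R `` {u} \<otimes>\<^bsub>presented_group X R\<^esub> pres_cong X R `` {v} = pres_cong X R `` {u @ v}"
proof -
  let ?c = "\<lambda>w. pres_cong X R `` {w}"
  have "?c (u' @ v') = ?c (u @ v)" if "u' \<in> ?c u" "v' \<in> ?c v" for u' v'
  proof -
    have "(u @ v, u' @ v') \<in> pres_cong X R"
      using that by (intro pres_cong.app) simp_all
    then show ?thesis
      using equiv_class_eq[OF equiv_pres_cong] by metis
  qed
  then have "(\<Union>u'\<in>?c u. \<Union>v'\<in>?c v. ?c (u' @ v')) = (\<Union>u'\<in>?c u. \<Union>v'\<in>?c v. ?c (u @ v))"
    by (intro HOL.refl SUP_cong) blast
  moreover have "?c u \<noteq> {}" "?c v \<noteq> {}"
    using assms pres_cong.refl by blast+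
  ultimately have "(\<Union>u'\<in>?c u. \<Union>v'\<in>?c v. ?c (u' @ v')) = ?c (u @ v)"
    by simp
  then show ?thesis
    by (simp add: presented_group_def)
qed

lemma pres_cong_inverse_word:
  assumes "w \<in> words X"
  shows "(rev (map (\<lambda>(s, b). (s, \<not> b)) w) @ w, []) \<in> pres_cong X R"
  using assms
proof (induction w)
  case Nil
  show ?case by (simp add: pres_cong.refl words_def)
next
  case (Cons x w)
  obtain s b where x: "x = (s, b)" by (cases x)
  have s: "s \<in> X" and w: "w \<in> words X"
    using Cons.prems by (auto simp: x words_def)
  let ?i = "rev (map (\<lambda>(s, b). (s, \<not> b)) w)"
  have i: "?i \<in> words X" using w by (auto simp: words_def)
  have "([(s, \<not> b), (s, b)], []) \<in> pres_cong X R"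
    using pres_cong.cancel[OF s, of "\<not> b"] by simp
  from pres_cong.app[OF pres_cong.refl[OF i] pres_cong.app[OF this pres_cong.refl[OF w]]]
  have "(?i @ [(s, \<not> b), (s, b)] @ w, ?i @ w) \<in> pres_cong X R" by simp
  from pres_cong.trans[OF this Cons.IH[OF w]] show ?case by (simp add: x)
qed

lemma group_presented_group: "group (presented_group X R)"
proof (rule groupI)
  let ?G = "presented_group X R" and ?c = "\<lambda>w. pres_cong X R `` {w}"
  have carrier: "carrier ?G = ?c ` words X"
    by (auto simp: presented_group_def quotient_def)
  have one: "\<one>\<^bsub>?G\<^esub> = ?c []" by (simp add: presented_group_def)
  have nil: "[] \<in> words X" by (simp add: words_def)
  have app: "u @ v \<in> words X" if "u \<in> words X" "v \<in> words X" for u v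
    using that by (auto simp: words_def)
  show "\<one>\<^bsub>?G\<^esub> \<in> carrier ?G" using nil by (auto simp: carrier one)
  fix x assume "x \<in> carrier ?G"
  then obtain u where u: "u \<in> words X" "x = ?c u" by (auto simp: carrier)
  show "\<one>\<^bsub>?G\<^esub> \<otimes>\<^bsub>?G\<^esub> x = x"
    using u nil by (simp add: one presented_group_mult)
  let ?i = "rev (map (\<lambda>(s, b). (s, \<not> b)) u)"
  have i: "?i \<in> words X" using u by (auto simp: words_def)
  have "?c ?i \<otimes>\<^bsub>?G\<^esub> x = \<one>\<^bsub>?G\<^esub>"
    using u i equiv_class_eq[OF equiv_pres_cong pres_cong_inverse_word[OF u(1)]]
    by (simp add: one presented_group_mult)
  then show "\<exists>y\<in>carrier ?G. y \<otimes>\<^bsub>?G\<^esub> x = \<one>\<^bsub>?G\<^esub>" using i by (auto simp: carrier)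
  fix y assume "y \<in> carrier ?G"
  then obtain v where v: "v \<in> words X" "y = ?c v" by (auto simp: carrier)
  show "x \<otimes>\<^bsub>?G\<^esub> y \<in> carrier ?G"
    using u v by (auto simp: presented_group_mult carrier app)
  fix z assume "z \<in> carrier ?G"
  then obtain w where w: "w \<in> words X" "z = ?c w" by (auto simp: carrier)
  show "x \<otimes>\<^bsub>?G\<^esub> y \<otimes>\<^bsub>?G\<^esub> z = x \<otimes>\<^bsub>?G\<^esub> (y \<otimes>\<^bsub>?G\<^esub> z)"
    using u v w by (simp add: presented_group_mult app)
qed


section \<open>Artin--Tits groups\<close>

record 'a coxeter_graph =
  verts :: "'a set"
  edges :: "'a set set"
  label :: "'a set \<Rightarrow> enat"

text \<open>
  The label is defined on every edge; an edge whose label is omitted in pictures has label \<open>3\<close>.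
\<close>

definition is_coxeter_graph :: "'a coxeter_graph \<Rightarrow> bool" where
  "is_coxeter_graph \<Gamma> \<longleftrightarrow>
     finite (verts \<Gamma>) \<and>
     (\<forall>e\<in>edges \<Gamma>. e \<subseteq> verts \<Gamma> \<and> card e = 2 \<and> 3 \<le> label \<Gamma> e)"

definition coxeter_matrix :: "'a coxeter_graph \<Rightarrow> 'a \<Rightarrow> 'a \<Rightarrow> enat" where
  "coxeter_matrix \<Gamma> s t =
     (if s = t then 1 else if {s, t} \<in> edges \<Gamma> then label \<Gamma> {s, t} else 2)"

fun alternating :: "'b \<Rightarrow> 'b \<Rightarrow> nat \<Rightarrow> 'b list" where
  "alternating a b 0 = []"
| "alternating a b (Suc m) = a # alternating b a m"

definition artin_relations :: "'a coxeter_graph \<Rightarrow> ('a word \<times> 'a word) set" where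
  "artin_relations \<Gamma> =
     {(alternating (s, True) (t, True) m, alternating (t, True) (s, True) m) | s t m.
        s \<in> verts \<Gamma> \<and> t \<in> verts \<Gamma> \<and> s \<noteq> t \<and> coxeter_matrix \<Gamma> s t = enat m}"

definition artin_group :: "'a coxeter_graph \<Rightarrow> 'a word set monoid" where
  "artin_group \<Gamma> = presented_group (verts \<Gamma>) (artin_relations \<Gamma>)"

definition artin_gen :: "'a coxeter_graph \<Rightarrow> 'a \<Rightarrow> 'a word set" where
  "artin_gen \<Gamma> s = pres_cong (verts \<Gamma>) (artin_relations \<Gamma>) `` {[(s, True)]}"

definition represents :: "'a coxeter_graph \<Rightarrow> 'a word \<Rightarrow> 'a word set \<Rightarrow> bool" where
  "represents \<Gamma> \<omega> \<alpha> \<longleftrightarrow> word_value (artin_group \<Gamma>) (artin_gen \<Gamma>) \<omega> = \<alpha>"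

definition standard_parabolic :: "'a coxeter_graph \<Rightarrow> 'a set \<Rightarrow> 'a word set set" where
  "standard_parabolic \<Gamma> T = generate (artin_group \<Gamma>) (artin_gen \<Gamma> ` T)"


section \<open>Codings and the word problem\<close>

text \<open>
  Words and subsets are fed to algorithms through a numbering \<open>num\<close> of the vertices, to be
  injective on the finite vertex set. Passing from one such numbering to another
  amounts to a finite substitution on letters, so the choice does not affect computability.
\<close>

definition word_code :: "('a \<Rightarrow> nat) \<Rightarrow> 'a word \<Rightarrow> nat" where
  "word_code num w = list_encode (map (\<lambda>(s, b). 2 * num s + of_bool b) w)"

definition word_option_code :: "('a \<Rightarrow> nat) \<Rightarrow> 'a word option \<Rightarrow> nat" where
  "word_option_code num x = (case x of None \<Rightarrow> 0 | Some w \<Rightarrow> Suc (word_code num w))"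

definition word_subset_code :: "('a \<Rightarrow> nat) \<Rightarrow> 'a word \<times> 'a set \<Rightarrow> nat" where
  "word_subset_code num = (\<lambda>(w, T). prod_encode (word_code num w, set_encode (num ` T)))"

definition word_problem_solvable :: "('a \<Rightarrow> nat) \<Rightarrow> 'a coxeter_graph \<Rightarrow> bool" where
  "word_problem_solvable num \<Gamma> \<longleftrightarrow>
     decidable_on (word_code num) (words (verts \<Gamma>))
       (\<lambda>\<omega>. represents \<Gamma> \<omega> \<one>\<^bsub>artin_group \<Gamma>\<^esub>)"

lemma inj_on_word_code:
  assumes "inj_on num X"
  shows "inj_on (word_code num) (words X)"
proof -
  have "b = c \<and> num s = num t"
    if "2 * num s + of_bool b = 2 * num t + (of_bool c :: nat)" for s t b c
    using that by (cases b; cases c) (simp_all, presburger+)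
  then have "inj_on (\<lambda>(s, b). 2 * num s + of_bool b :: nat) (X \<times> UNIV)"
    using assms by (auto simp: inj_on_def)
  then have "inj_on (map (\<lambda>(s, b). 2 * num s + of_bool b :: nat)) (words X)"
    unfolding words_def by (rule inj_on_map_lists)
  then show ?thesis
    unfolding word_code_def by (simp add: inj_on_def list_encode_eq)
qed

end

theory Submission
  imports Defs Complex_Main
begin

text \<open>
  Let \<open>W\<close> be the Coxeter group of \<open>\<Gamma>\<close>. The right cosets \<open>W\<^sub>T w\<close> are the states of a
  transducer: from the minimal representative \<open>w\<close>, reading \<open>\<sigma>\<^sub>s\<close> or its inverse either moves to the
  minimal representative \<open>ws\<close>, or \<open>ws = tw\<close> with \<open>t \<in> T\<close>, in which case the state stays and the
  letter \<open>\<sigma>\<^sub>t\<close> with the same sign is output. A reduced input has a reduced output, and \<open>W\<^sub>T w\<close>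
  decomposes uniquely, so the two sides of a braid relation give reduced words of the same element of
  \<open>W\<^sub>T\<close>; these are equal in \<open>A\<^sub>T\<close> by Matsumoto's theorem. Hence the output, as an element of the
  group, depends only on \<open>\<alpha>\<close>, and it is \<open>\<alpha>\<close> itself when \<open>\<alpha> \<in> A\<^sub>T\<close>. So \<open>\<alpha> \<in> A\<^sub>T\<close> if and only if
  the output represents \<open>\<alpha>\<close>.

  The transducer can be run with the word problem of \<open>A\<close> alone: if states are kept as reduced positive
  words, then by Matsumoto's theorem the comparisons needed in \<open>W\<close> are comparisons of positive words
  in \<open>A\<close>, and by the exchange condition a reduced word of a shorter \<open>ws\<close> arises from one of \<open>w\<close> by
  deleting a letter.
\<close>

subsection \<open>Closure properties of recursive functions\<close>

lemma recursive_cong: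
  "recursive n f \<Longrightarrow> (\<And>xs. length xs = n \<Longrightarrow> f xs = g xs) \<Longrightarrow> recursive n g"
  by (rule recursive.ext) blast+

lemma recursive_comp1: "recursive 1 f \<Longrightarrow> recursive n g \<Longrightarrow> recursive n (\<lambda>xs. f [g xs])"
  using recursive.comp[of "[g]" f n] by simp

lemma recursive_comp2:
  assumes "recursive 2 f" "recursive n g" "recursive n h"
  shows "recursive n (\<lambda>xs. f [g xs, h xs])"
  using recursive.comp[of "[g, h]" f n] assms by (simp add: numeral_2_eq_2)

lemma recursive_Suc: "recursive n g \<Longrightarrow> recursive n (\<lambda>xs. Suc (g xs))"
  using recursive_comp1[OF recursive.succ, of n g] by simp

lemma recursive_const: "recursive n (\<lambda>xs. c)"
  by (induction c) (auto intro: recursive.zero recursive_Suc)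

lemma recursive_rec_nat2:
  assumes "recursive 1 f" "recursive 3 g"
  shows "recursive 2 (\<lambda>xs. rec_nat (f [xs ! 1]) (\<lambda>k r. g [k, r, xs ! 1]) (xs ! 0))"
proof -
  have "recursive (1 + 1) (\<lambda>xs. rec_nat (f (tl xs)) (\<lambda>k r. g (k # r # tl xs)) (hd xs))"
    using assms by (intro recursive.prim_rec) (simp_all add: numeral_3_eq_3)
  then have "recursive 2 (\<lambda>xs. rec_nat (f (tl xs)) (\<lambda>k r. g (k # r # tl xs)) (hd xs))"
    by (simp add: numeral_2_eq_2)
  then show ?thesis
  proof (rule recursive_cong)
    fix xs :: "nat list" assume "length xs = 2"
    then obtain a b where "xs = [a, b]" by (auto simp: numeral_2_eq_2 length_Suc_conv)
    then show "rec_nat (f (tl xs)) (\<lambda>k r. g (k # r # tl xs)) (hd xs)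
        = rec_nat (f [xs ! 1]) (\<lambda>k r. g [k, r, xs ! 1]) (xs ! 0)" by simp
  qed
qed

lemma recursive_rec_nat1:
  assumes "recursive 2 g"
  shows "recursive 1 (\<lambda>xs. rec_nat a (\<lambda>k r. g [k, r]) (xs ! 0))"
proof -
  have "recursive (0 + 1) (\<lambda>xs. rec_nat a (\<lambda>k r. g (k # r # tl xs)) (hd xs))"
    using assms recursive.prim_rec[OF recursive_const[of 0 a], of g] by (simp add: numeral_2_eq_2)
  then have "recursive 1 (\<lambda>xs. rec_nat a (\<lambda>k r. g (k # r # tl xs)) (hd xs))" by simp
  then show ?thesis
    by (rule recursive_cong) (auto simp: length_Suc_conv)
qed

text \<open>The recursion scheme behind the folds and searches below: both iterate a step on a coded
  state.\<close>

lemma recursive_funpow: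
  assumes "recursive 1 f"
  shows "recursive 2 (\<lambda>xs. ((\<lambda>y. f [y]) ^^ (xs ! 0)) (xs ! 1))"
proof -
  have "recursive 2 (\<lambda>xs. rec_nat ([xs ! 1] ! 0) (\<lambda>k r. (\<lambda>ys. f [ys ! 1]) [k, r, xs ! 1]) (xs ! 0))"
    by (intro recursive_rec_nat2 recursive_comp1[OF assms] recursive.proj) simp_all
  then show ?thesis
  proof (rule recursive_cong)
    fix xs :: "nat list"
    have "rec_nat a (\<lambda>k r. f [r]) n = ((\<lambda>y. f [y]) ^^ n) a" for a n
      by (induction n) simp_all
    then show "rec_nat ([xs ! 1] ! 0) (\<lambda>k r. (\<lambda>ys. f [ys ! 1]) [k, r, xs ! 1]) (xs ! 0)
        = ((\<lambda>y. f [y]) ^^ (xs ! 0)) (xs ! 1)" by simp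
  qed
qed

lemma recursive_add: "recursive 2 (\<lambda>xs. xs ! 0 + xs ! 1)"
proof -
  have s: "(\<lambda>y. Suc ([y] ! 0)) = Suc" by auto
  have "(Suc ^^ a) b = a + b" for a b by (induction a) simp_all
  then show ?thesis using recursive_funpow[OF recursive.succ] unfolding s by simp
qed

lemma recursive_pred: "recursive 1 (\<lambda>xs. xs ! 0 - 1)"
proof -
  have "recursive 1 (\<lambda>xs. rec_nat 0 (\<lambda>k r. (\<lambda>ys. ys ! 0) [k, r]) (xs ! 0))"
    by (intro recursive_rec_nat1 recursive.proj) simp
  then show ?thesis
  proof (rule recursive_cong)
    fix xs :: "nat list"
    show "rec_nat 0 (\<lambda>k r. (\<lambda>ys. ys ! 0) [k, r]) (xs ! 0) = xs ! 0 - 1" by (cases "xs ! 0") simp_all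
  qed
qed

text \<open>The order of the arguments comes from iterating the predecessor: the number of
  iterations stands first in \<open>recursive_funpow\<close>.\<close>

lemma recursive_minus: "recursive 2 (\<lambda>xs. xs ! 1 - xs ! 0)"
proof -
  have "((\<lambda>y. y - 1) ^^ a) b = b - a" for a b :: nat by (induction a) simp_all
  then show ?thesis using recursive_funpow[OF recursive_pred] by simp
qed

lemma recursive_plus: "recursive n f \<Longrightarrow> recursive n g \<Longrightarrow> recursive n (\<lambda>xs. f xs + g xs)"
  using recursive_comp2[OF recursive_add, of n f g] by simp

lemma recursive_diff: "recursive n f \<Longrightarrow> recursive n g \<Longrightarrow> recursive n (\<lambda>xs. f xs - g xs)"
  using recursive_comp2[OF recursive_minus, of n g f] by simp

lemma recursive_mult: "recursive n f \<Longrightarrow> recursive n g \<Longrightarrow> recursive n (\<lambda>xs. f xs * g xs)"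
proof -
  have r: "recursive 2 (\<lambda>xs. rec_nat ((\<lambda>_. 0) [xs ! 1]) (\<lambda>k r. (\<lambda>ys. ys ! 1 + ys ! 2) [k, r, xs ! 1]) (xs ! 0))"
    by (intro recursive_rec_nat2 recursive_const recursive_plus recursive.proj) simp_all
  have "rec_nat 0 (\<lambda>k r. r + b) a = a * b" for a b :: nat by (induction a) simp_all
  then have "recursive 2 (\<lambda>xs. xs ! 0 * xs ! 1)" using r by simp
  then show "recursive n f \<Longrightarrow> recursive n g \<Longrightarrow> recursive n (\<lambda>xs. f xs * g xs)"
    using recursive_comp2[of _ n f g] by fastforce
qed

text \<open>\<open>prod_encode\<close> is the Cantor pairing \<open>triangle (a + b) + a\<close>, so
  triangular numbers are what coding pairs requires beyond addition.\<close>

lemma recursive_triangle: "recursive n f \<Longrightarrow> recursive n (\<lambda>xs. triangle (f xs))"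
proof -
  have r: "recursive 1 (\<lambda>xs. rec_nat 0 (\<lambda>k r. (\<lambda>ys. ys ! 1 + Suc (ys ! 0)) [k, r]) (xs ! 0))"
    by (intro recursive_rec_nat1 recursive_plus recursive_Suc recursive.proj) simp_all
  have "rec_nat 0 (\<lambda>k r. r + Suc k) a = triangle a" for a by (induction a) simp_all
  then have "recursive 1 (\<lambda>xs. triangle (xs ! 0))" using r by simp
  then show "recursive n f \<Longrightarrow> recursive n (\<lambda>xs. triangle (f xs))"
    using recursive_comp1[of _ n f] by fastforce
qed

subsection \<open>Computable functions between coded types\<close>

abbreviation computable :: "('x \<Rightarrow> nat) \<Rightarrow> ('y \<Rightarrow> nat) \<Rightarrow> ('x \<Rightarrow> 'y) \<Rightarrow> bool" where
  "computable ea eb f \<equiv> computable_on ea UNIV eb f"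

definition pair_code :: "('x \<Rightarrow> nat) \<Rightarrow> ('y \<Rightarrow> nat) \<Rightarrow> 'x \<times> 'y \<Rightarrow> nat" where
  "pair_code ea eb = (\<lambda>(x, y). prod_encode (ea x, eb y))"

lemma computableI: "recursive 1 g \<Longrightarrow> (\<And>x. g [ea x] = eb (f x)) \<Longrightarrow> computable ea eb f"
  by (auto simp: computable_on_def)

lemma computableE:
  assumes "computable ea eb f"
  obtains g where "recursive 1 g" "\<And>x. g [ea x] = eb (f x)"
  using assms by (auto simp: computable_on_def)

lemma computable_ident: "computable ea ea (\<lambda>x. x)"
  by (rule computableI[OF recursive.proj[of 0 1]]) simp_all

lemma computable_const: "computable ea eb (\<lambda>x. c)"
  by (rule computableI[OF recursive_const[of 1 "eb c"]]) simp

lemma computable_comp: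
  assumes "computable ea eb f" "computable eb ec g"
  shows "computable ea ec (\<lambda>x. g (f x))"
proof -
  obtain f' g' where f': "recursive 1 f'" "\<And>x. f' [ea x] = eb (f x)"
    and g': "recursive 1 g'" "\<And>y. g' [eb y] = ec (g y)"
    using assms by (metis computableE)
  show ?thesis
    by (rule computableI[OF recursive_comp1[OF g'(1) f'(1)]]) (simp add: f' g')
qed

lemma computable_Suc: "computable id id Suc"
  by (rule computableI[OF recursive.succ]) simp

lemma computable_pair:
  assumes "computable ea eb f" "computable ea ec g"
  shows "computable ea (pair_code eb ec) (\<lambda>x. (f x, g x))"
proof -
  obtain f' g' where f': "recursive 1 f'" "\<And>x. f' [ea x] = eb (f x)"
    and g': "recursive 1 g'" "\<And>x. g' [ea x] = ec (g x)"
    using assms by (metis computableE)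
  have "recursive 1 (\<lambda>xs. triangle (f' xs + g' xs) + f' xs)"
    by (intro recursive_plus recursive_triangle f' g')
  then show ?thesis
    by (rule computableI) (simp add: f' g' pair_code_def prod_encode_def)
qed

lemma prod_decode_parts:
  assumes "z < triangle (Suc k)" "triangle k \<le> z"
  shows "prod_decode z = (z - triangle k, k - (z - triangle k))"
proof -
  have "z - triangle k \<le> k" using assms by simp
  then have "prod_encode (z - triangle k, k - (z - triangle k)) = z"
    using assms by (simp add: prod_encode_def)
  then show ?thesis by (metis prod_encode_inverse)
qed

lemma recursive_prod_decode:
  "recursive 1 (\<lambda>xs. fst (prod_decode (xs ! 0)))" "recursive 1 (\<lambda>xs. snd (prod_decode (xs ! 0)))"
proof -
  \<comment> \<open>The diagonal of the Cantor pairing on which \<open>z\<close> lies: the least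
    \<open>y\<close> with \<open>z < triangle (Suc y)\<close>, phrased as the vanishing of a
    truncated difference to fit \<open>minim\<close>.\<close>
  define k where "k z = (LEAST y. Suc z - triangle (Suc y) = 0)" for z
  have ge: "y \<le> triangle y" for y by (induction y) simp_all
  have ex: "\<exists>y. Suc z - triangle (Suc y) = 0" for z
    using ge[of "Suc z"] by (intro exI[of _ z]) simp
  have "recursive (1 + 1) (\<lambda>xs. Suc (xs ! 1) - triangle (Suc (xs ! 0)))"
    by (intro recursive_diff recursive_Suc recursive_triangle recursive.proj) simp_all
  from recursive.minim[OF this] have k: "recursive 1 (\<lambda>xs. k (xs ! 0))"
    using ex by (simp add: k_def del: triangle_Suc)
  have upper: "z < triangle (Suc (k z))" for z
    using LeastI_ex[OF ex[of z]] by (simp add: k_def del: triangle_Suc)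
  have lower: "triangle (k z) \<le> z" for z
  proof (cases "k z")
    case (Suc j)
    then have "\<not> Suc z - triangle (Suc j) = 0"
      using not_less_Least[of j "\<lambda>y. Suc z - triangle (Suc y) = 0"] by (simp add: k_def)
    then show ?thesis using Suc by simp
  qed simp
  have d: "prod_decode z = (z - triangle (k z), k z - (z - triangle (k z)))" for z
    by (rule prod_decode_parts[OF upper lower])
  show "recursive 1 (\<lambda>xs. fst (prod_decode (xs ! 0)))"
    unfolding d fst_conv by (intro recursive_diff recursive_triangle k recursive.proj) simp_all
  show "recursive 1 (\<lambda>xs. snd (prod_decode (xs ! 0)))"
    unfolding d snd_conv by (intro recursive_diff recursive_triangle k recursive.proj) simp_all
qed

lemma computable_fst': "computable (pair_code ea eb) ea fst"
  by (rule computableI[OF recursive_prod_decode(1)]) (auto simp: pair_code_def)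

lemma computable_snd': "computable (pair_code ea eb) eb snd"
  by (rule computableI[OF recursive_prod_decode(2)]) (auto simp: pair_code_def)

lemma computable_fst: "computable ea (pair_code eb ec) f \<Longrightarrow> computable ea eb (\<lambda>x. fst (f x))"
  by (rule computable_comp[OF _ computable_fst'])

lemma computable_snd: "computable ea (pair_code eb ec) f \<Longrightarrow> computable ea ec (\<lambda>x. snd (f x))"
  by (rule computable_comp[OF _ computable_snd'])

lemma computable_funpow:
  assumes "computable eb eb f" "computable ea id n" "computable ea eb g"
  shows "computable ea eb (\<lambda>x. (f ^^ n x) (g x))"
proof -
  obtain f' n' g' where f': "recursive 1 f'" "\<And>x. f' [eb x] = eb (f x)"
    and n': "recursive 1 n'" "\<And>x. n' [ea x] = id (n x)"
    and g': "recursive 1 g'" "\<And>x. g' [ea x] = eb (g x)"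
    using assms by (metis computableE)
  have "((\<lambda>y. f' [y]) ^^ k) (eb y) = eb ((f ^^ k) y)" for k y
    by (induction k) (simp_all add: f')
  then show ?thesis
    by (intro computableI[OF recursive_comp2[OF recursive_funpow[OF f'(1)] n'(1) g'(1)]])
      (simp add: n' g')
qed

lemma computable_if:
  assumes "computable ea of_bool p" "computable ea eb f" "computable ea eb g"
  shows "computable ea eb (\<lambda>x. if p x then f x else g x)"
proof -
  obtain p' f' g' where p': "recursive 1 p'" "\<And>x. p' [ea x] = of_bool (p x)"
    and f': "recursive 1 f'" "\<And>x. f' [ea x] = eb (f x)"
    and g': "recursive 1 g'" "\<And>x. g' [ea x] = eb (g x)"
    using assms by (metis computableE)
  have "recursive 1 (\<lambda>xs. p' xs * f' xs + (1 - p' xs) * g' xs)"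
    by (intro recursive_plus recursive_mult recursive_diff recursive_const p' f' g')
  then show ?thesis by (rule computableI) (simp add: p' f' g')
qed

lemma computable_eq_const:
  assumes "computable ea id f"
  shows "computable ea of_bool (\<lambda>x. f x = c)"
proof -
  obtain f' where f': "recursive 1 f'" "\<And>x. f' [ea x] = id (f x)"
    using assms by (metis computableE)
  \<comment> \<open>One of the two truncated differences is always 0, so their sum is the distance
    to \<open>c\<close>.\<close>
  have "recursive 1 (\<lambda>xs. 1 - ((f' xs - c) + (c - f' xs)))"
    by (intro recursive_plus recursive_diff recursive_const f')
  then show ?thesis by (rule computableI) (auto simp: f')
qed

lemma computable_disj:
  assumes "computable ea of_bool p" "computable ea of_bool q"
  shows "computable ea of_bool (\<lambda>x. p x \<or> q x)"
proof -
  have "computable ea of_bool (\<lambda>x. if p x then True else q x)"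
    by (intro computable_if assms computable_const)
  moreover have "(\<lambda>x. if p x then True else q x) = (\<lambda>x. p x \<or> q x)" by auto
  ultimately show ?thesis by (simp only:)
qed

text \<open>A finite table may be hard-wired as nested conditionals, so the dependence of
  \<open>f a\<close> on \<open>a\<close> need not be computable. Letters and subsets of vertices are
  both decoded in this way.\<close>

lemma computable_finite_cases:
  assumes "finite A" "computable ea id k" "\<And>a. a \<in> A \<Longrightarrow> computable ea eb (f a)"
    "computable ea eb g"
  shows "computable ea eb (\<lambda>x. if k x \<in> A then f (k x) x else g x)"
  using assms(1,3)
proof (induction A)
  case (insert a A)
  have "computable ea eb (\<lambda>x. if k x = a then f a x else if k x \<in> A then f (k x) x else g x)"
    using insert by (intro computable_if[OF computable_eq_const[OF assms(2)]]) simp_all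
  moreover have "(\<lambda>x. if k x = a then f a x else if k x \<in> A then f (k x) x else g x) =
      (\<lambda>x. if k x \<in> insert a A then f (k x) x else g x)" by auto
  ultimately show ?case by simp
qed (simp add: assms(4))

lemma computable_find:
  assumes "\<And>a. a \<in> set as \<Longrightarrow> computable ea of_bool (p a)"
    "\<And>a. a \<in> set as \<Longrightarrow> computable ea eb (f a)" "computable ea eb g"
  shows "computable ea eb (\<lambda>x. case find (\<lambda>a. p a x) as of None \<Rightarrow> g x | Some a \<Rightarrow> f a x)"
  using assms(1,2)
proof (induction as)
  case (Cons a as)
  have "computable ea eb (\<lambda>x. if p a x then f a x else
      case find (\<lambda>a. p a x) as of None \<Rightarrow> g x | Some a \<Rightarrow> f a x)"
    using Cons by (intro computable_if) simp_all
  moreover have "(\<lambda>x. if p a x then f a x else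
      case find (\<lambda>a. p a x) as of None \<Rightarrow> g x | Some a \<Rightarrow> f a x) =
      (\<lambda>x. case find (\<lambda>a. p a x) (a # as) of None \<Rightarrow> g x | Some a \<Rightarrow> f a x)" by auto
  ultimately show ?case by simp
qed (simp add: assms(3))

subsection \<open>Computable list functions\<close>

abbreviation "computable_list ea f \<equiv> computable ea list_encode f"

lemma computable_Cons:
  assumes "computable ea id a" "computable_list ea l"
  shows "computable_list ea (\<lambda>x. a x # l x)"
proof -
  have "computable ea (pair_code id list_encode) (\<lambda>x. (a x, l x))"
    by (rule computable_pair[OF assms])
  then obtain g where g: "recursive 1 g" "\<And>x. g [ea x] = pair_code id list_encode (a x, l x)"
    unfolding computable_on_def by blast
  show ?thesis
    by (rule computableI[OF recursive_Suc[OF g(1)]]) (simp add: g(2) pair_code_def)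
qed

text \<open>The code 0 of the empty list stays 0 under the truncated predecessor and decodes to head
  0 and tail \<open>[]\<close>. This is where the default value of \<open>hd0\<close> comes
  from.\<close>

lemma prod_decode_0: "prod_decode 0 = (0, 0)"
  using prod_encode_inverse[of "(0, 0)"] by (simp add: prod_encode_def)

lemma computable_tl:
  assumes "computable_list ea l" shows "computable_list ea (\<lambda>x. tl (l x))"
proof -
  obtain l' where l': "recursive 1 l'" "\<And>x. l' [ea x] = list_encode (l x)"
    using assms by (metis computableE)
  note r = recursive_comp1[OF recursive_prod_decode(2) recursive_diff[OF l'(1) recursive_const[of 1 1]]]
  have "snd (prod_decode (list_encode l - 1)) = list_encode (tl l)" for l
    by (cases l) (simp_all add: prod_decode_0)
  then show ?thesis by (intro computableI[OF r]) (simp add: l'(2))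
qed

definition hd0 :: "nat list \<Rightarrow> nat" where
  "hd0 l = (case l of [] \<Rightarrow> 0 | a # _ \<Rightarrow> a)"

lemma hd0_Cons [simp]: "hd0 (a # l) = a"
  by (simp add: hd0_def)

lemma computable_hd0:
  assumes "computable_list ea l" shows "computable ea id (\<lambda>x. hd0 (l x))"
proof -
  obtain l' where l': "recursive 1 l'" "\<And>x. l' [ea x] = list_encode (l x)"
    using assms by (metis computableE)
  note r = recursive_comp1[OF recursive_prod_decode(1) recursive_diff[OF l'(1) recursive_const[of 1 1]]]
  have "fst (prod_decode (list_encode l - 1)) = hd0 l" for l
    by (cases l) (simp_all add: prod_decode_0 hd0_def)
  then show ?thesis by (intro computableI[OF r]) (simp add: l'(2))
qed

lemma computable_list_encode:
  assumes "computable_list ea l" shows "computable ea id (\<lambda>x. list_encode (l x))"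
  using assms by (simp add: computable_on_def)

lemma computable_null:
  assumes "computable_list ea l" shows "computable ea of_bool (\<lambda>x. l x = [])"
proof -
  have "computable ea of_bool (\<lambda>x. list_encode (l x) = list_encode [])"
    by (intro computable_eq_const computable_list_encode assms)
  then show ?thesis by (simp only: list_encode_eq)
qed

lemma length_le_list_encode: "length l \<le> list_encode l"
proof (induction l)
  case (Cons a l)
  then show ?case using le_prod_encode_2[of "list_encode l" a] by simp
qed simp

text \<open>The code of a list bounds its length and serves as the number of iterations.\<close>

lemma computable_fold:
  assumes "computable (pair_code id eb) eb (\<lambda>(a, y). f a y)" "computable_list ea l" "computable ea eb g"
  shows "computable ea eb (\<lambda>x. fold f (l x) (g x))"
proof -
  \<comment> \<open>States with an empty list are fixed points, so surplus iterations are
    harmless.\<close>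
  define step where "step z = (if fst z = [] then z else (tl (fst z), f (hd0 (fst z)) (snd z)))" for z
  let ?e = "pair_code list_encode eb"
  note fs = computable_fst[OF computable_ident] computable_snd[OF computable_ident]
  have f: "computable ?e eb (\<lambda>z. f (hd0 (fst z)) (snd z))"
    using computable_comp[OF computable_pair[OF computable_hd0[OF fs(1)] fs(2)] assms(1)] by simp
  have step: "computable ?e ?e step"
    unfolding step_def[abs_def]
    by (intro computable_if computable_null fs computable_ident computable_pair computable_tl f)
  have run: "(step ^^ n) (l, y) = ([], fold f l y)" if "length l \<le> n" for n l y
    using that
  proof (induction n arbitrary: l y)
    case (Suc n)
    have "(step ^^ Suc n) (l, y) = (step ^^ n) (step (l, y))"
      unfolding funpow_Suc_right by simp
    also have "\<dots> = ([], fold f l y)"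
    proof (cases l)
      case Nil
      then have "step (l, y) = ([], y)" by (simp add: step_def)
      then show ?thesis using Suc.IH[of "[]" y] Nil by simp
    next
      case (Cons a l')
      then have "step (l, y) = (l', f a y)" by (simp add: step_def)
      then show ?thesis using Suc.IH[of l' "f a y"] Suc.prems Cons by simp
    qed
    finally show ?case .
  qed simp
  have "computable ea eb (\<lambda>x. snd ((step ^^ list_encode (l x)) (l x, g x)))"
    using computable_snd[OF computable_funpow[OF step computable_list_encode[OF assms(2)]
          computable_pair[OF assms(2,3)]]] .
  then show ?thesis by (simp add: run length_le_list_encode)
qed

lemma computable_rev_map:
  assumes "computable id id f" "computable_list ea l"
  shows "computable_list ea (\<lambda>x. rev (map f (l x)))"
proof -
  have e: "fold (\<lambda>a y. f a # y) l y = rev (map f l) @ y" for l y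
    by (induction l arbitrary: y) simp_all
  have "computable_list (pair_code id list_encode) (\<lambda>z. f (fst z) # snd z)"
    by (intro computable_Cons computable_comp[OF _ assms(1)] computable_fst[OF computable_ident]
        computable_snd[OF computable_ident])
  then have "computable_list ea (\<lambda>x. fold (\<lambda>a y. f a # y) (l x) [])"
    by (intro computable_fold assms computable_const) (simp add: case_prod_unfold)
  then show ?thesis by (simp add: e)
qed

lemma computable_rev:
  assumes "computable_list ea l" shows "computable_list ea (\<lambda>x. rev (l x))"
  using computable_rev_map[OF computable_ident assms] by simp

lemma computable_append:
  assumes "computable_list ea l" "computable_list ea l'"
  shows "computable_list ea (\<lambda>x. l x @ l' x)"
proof -
  have "computable_list (pair_code id list_encode) (\<lambda>(a, y). a # y)"
    using computable_Cons[OF computable_fst[OF computable_ident] computable_snd[OF computable_ident]]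
    unfolding case_prod_unfold .
  from computable_fold[OF this computable_rev[OF assms(1)] assms(2)]
  have "computable_list ea (\<lambda>x. fold Cons (rev (l x)) (l' x))" .
  then show ?thesis by (simp add: fold_Cons_rev)
qed

subsection \<open>The geometric representation of a Coxeter group\<close>

locale coxeter =
  fixes m :: "'a \<Rightarrow> 'a \<Rightarrow> enat"
  assumes m_sym: "m s t = m t s"
    and m_ge2: "s \<noteq> t \<Longrightarrow> 2 \<le> m s t"
begin

text \<open>
  A function \<open>f\<close> is a linear form on the root space, given by its values on the simple roots, and
  \<open>act x f s\<close> is the value of \<open>f\<close> at the root \<open>x \<alpha>\<^sub>s\<close>. This is the numbers game.
\<close>

definition cartan :: "'a \<Rightarrow> 'a \<Rightarrow> real" where
  "cartan s t = (if s = t then 2 else case m s t of enat n \<Rightarrow> - 2 * cos (pi / n) | \<infinity> \<Rightarrow> - 2)"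

text \<open>\<open>cartan s r\<close> is twice the bilinear form at \<open>\<alpha>\<^sub>s\<close>
  and \<open>\<alpha>\<^sub>r\<close>, so \<open>fire s f\<close> is the form \<open>f\<close>
  composed with the reflection in \<open>\<alpha>\<^sub>s\<close>. Working with forms avoids
  constructing the root space.\<close>

definition fire :: "'a \<Rightarrow> ('a \<Rightarrow> real) \<Rightarrow> 'a \<Rightarrow> real" where
  "fire s f = (\<lambda>r. f r - cartan s r * f s)"

definition act :: "'a list \<Rightarrow> ('a \<Rightarrow> real) \<Rightarrow> 'a \<Rightarrow> real" where
  "act x = fold fire x"

lemma act_simps [simp]: "act [] f = f" "act (s # x) f = act x (fire s f)"
  by (simp_all add: act_def)

lemma act_append [simp]: "act (x @ y) f = act y (act x f)"
  by (simp add: act_def)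

lemma cartan_self [simp]: "cartan s s = 2"
  by (simp add: cartan_def)

lemma cartan_sym: "cartan s t = cartan t s"
  by (simp add: cartan_def m_sym)

lemma fire_fire [simp]: "fire s (fire s f) = f"
  by (simp add: fire_def fun_eq_iff)

lemma fire_self [simp]: "fire s f s = - f s"
  by (simp add: fire_def)

lemma act_rev [simp]: "act (rev x) (act x f) = f" "act x (act (rev x) f) = f"
  by (induction x arbitrary: f) simp_all

lemma act_lincomb: "act x (\<lambda>r. a * f r + b * g r) = (\<lambda>r. a * act x f r + b * act x g r)"
proof (induction x arbitrary: f g)
  case (Cons s x)
  have "fire s (\<lambda>r. a * f r + b * g r) = (\<lambda>r. a * fire s f r + b * fire s g r)"
    by (simp add: fire_def fun_eq_iff algebra_simps)
  then show ?case by (simp add: Cons.IH)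
qed simp

lemma act_diff_scaled: "act x (\<lambda>r. f r - b * g r) = (\<lambda>r. act x f r - b * act x g r)"
  using act_lincomb[of x 1 f "- b" g] by simp

section \<open>Rank two: Chebyshev polynomials and the braid relations\<close>

fun chebU :: "real \<Rightarrow> nat \<Rightarrow> real" where
  "chebU c 0 = 0"
| "chebU c (Suc 0) = 1"
| "chebU c (Suc (Suc n)) = c * chebU c (Suc n) - chebU c n"

lemma chebU_two: "chebU 2 n = n"
  by (induction "2::real" n rule: chebU.induct) simp_all

text \<open>\<open>chebU c n\<close> is the Chebyshev polynomial of the second kind of degree
  \<open>n - 1\<close>, evaluated at \<open>c / 2\<close>; this is its trigonometric form.\<close>

lemma chebU_cos: "chebU (2 * cos a) n * sin a = sin (n * a)"
proof (induction "2 * cos a" n rule: chebU.induct)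
  case (3 n)
  have "sin (real (Suc (Suc n)) * a) + sin (n * a) = 2 * cos a * sin (real (Suc n) * a)"
    using sin_plus_sin[of "real (Suc (Suc n)) * a" "n * a"]
    by (simp add: algebra_simps add_divide_distrib)
  then show ?case using 3 by (simp add: left_diff_distrib mult.assoc)
qed simp_all

lemma alternating_snoc:
  "alternating a b (Suc k) = alternating a b k @ [if even k then a else b]"
  by (induction a b k rule: alternating.induct) auto

lemma length_alternating [simp]: "length (alternating a b k) = k"
  by (induction a b k rule: alternating.induct) auto

text \<open>The action of a dihedral subgroup on simple roots. The first two parts treat the letter
  that would continue the word and its last letter; they need each other because appending a letter
  exchanges these roles. Any other simple root only gains multiples of the two roots.\<close>

lemma act_alternating:
  fixes f :: "'a \<Rightarrow> real"
  assumes "s \<noteq> t"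
  defines "U \<equiv> chebU (- cartan s t)"
  shows "act (alternating s t k) f (if even k then s else t) = U (Suc k) * f s + U k * f t"
    and "act (alternating s t k) f (if even k then t else s) =
      - (U k * f s + (- cartan s t * U k - U (Suc k)) * f t)"
    and "r \<noteq> s \<Longrightarrow> r \<noteq> t \<Longrightarrow> act (alternating s t k) f r =
      f r - cartan s r * (\<Sum>j<k. if even j then U (Suc j) * f s + U j * f t else 0)
          - cartan t r * (\<Sum>j<k. if even j then 0 else U (Suc j) * f s + U j * f t)"
proof (induction k)
  case 0
  { case 1 show ?case by (simp add: U_def) }
  { case 2 show ?case by (simp add: U_def) }
  { case 3 show ?case by simp }
next
  case (Suc k)
  note snoc = alternating_snoc[of s t k]
  { case 1
    show ?case using Suc(1,2) assms(1) unfolding snoc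
      by (auto simp: fire_def cartan_sym[of t s] U_def algebra_simps) }
  { case 2
    show ?case using Suc(1,2) assms(1) unfolding snoc
      by (auto simp: U_def algebra_simps split: if_splits) }
  { case 3
    then show ?case using Suc(1) Suc(3)[OF 3] unfolding snoc
      by (auto simp: fire_def algebra_simps split: if_splits) }
qed

text \<open>At the angle \<open>pi / n\<close> the sine formula produces sin pi = 0 and sin (pi + pi
  / n) = - sin (pi / n).\<close>

lemma chebU_period:
  assumes "s \<noteq> t" "m s t = enat n"
  shows "chebU (- cartan s t) n = 0" "chebU (- cartan s t) (Suc n) = - 1"
proof -
  have n: "2 \<le> n" using m_ge2[OF assms(1)] assms(2) by (simp add: numeral_eq_enat)
  have c: "- cartan s t = 2 * cos (pi / n)" using assms by (simp add: cartan_def)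
  have s: "sin (pi / n) > 0" using n by (intro sin_gt_zero) (auto simp: field_simps)
  show z: "chebU (- cartan s t) n = 0"
    using chebU_cos[of "pi / n" n] n s by (simp add: c)
  have "sin (Suc n * (pi / n)) = - sin (pi / n)"
  proof -
    have "Suc n * (pi / n) = pi / n + pi" using n by (simp add: field_simps)
    then show ?thesis by (simp only: sin_periodic_pi)
  qed
  then show "chebU (- cartan s t) (Suc n) = - 1"
    using chebU_cos[of "pi / n" "Suc n"] s by (simp add: c) (metis less_irrefl minus_mult_left mult_cancel_right mult_1)
qed

text \<open>Up to the label the argument of the sine stays between 0 and \<open>pi\<close>; for an
  infinite label the values are \<open>chebU 2 k = k\<close>.\<close>

lemma chebU_nonneg:
  assumes "s \<noteq> t" "enat k \<le> m s t"
  shows "0 \<le> chebU (- cartan s t) k"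
proof (cases "m s t")
  case (enat n)
  have n: "2 \<le> n" using m_ge2[OF assms(1)] enat by (simp add: numeral_eq_enat)
  have c: "- cartan s t = 2 * cos (pi / n)" using assms enat by (simp add: cartan_def)
  have s: "sin (pi / n) > 0" using n by (intro sin_gt_zero) (auto simp: field_simps)
  have "k \<le> n" using assms enat by simp
  then have "0 \<le> sin (k * (pi / n))"
    using n by (intro sin_ge_zero) (auto simp: field_simps)
  then show ?thesis using chebU_cos[of "pi / n" k] s
    by (simp add: c) (metis mult_le_cancel_right mult_zero_left not_less)
next
  case infinity
  then have "- cartan s t = 2" using assms by (simp add: cartan_def)
  then show ?thesis by (simp only: chebU_two)
qed

text \<open>Compares the multiples of one simple root that the two alternating words contribute to a
  third root. The boundary term vanishes when \<open>U k = 0\<close>, in particular at the length of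
  the braid relation.\<close>

lemma sum_alternating_parity:
  fixes U :: "nat \<Rightarrow> real"
  assumes "U 0 = 0"
  shows "(\<Sum>j<k. if even j then U (Suc j) * a + U j * b else 0) +
      (if even k then U k * b else - U k * a) =
    (\<Sum>j<k. if even j then 0 else U (Suc j) * b + U j * a)"
proof (induction k)
  case (Suc k)
  then show ?case by (cases "even k") simp_all
qed (simp add: assms)

lemma act_braid:
  assumes "s \<noteq> t" "m s t = enat n"
  shows "act (alternating s t n) = act (alternating t s n)"
proof (intro HOL.ext)
  fix f r
  let ?U = "chebU (- cartan s t)"
  have U: "chebU (- cartan t s) = ?U" by (simp add: cartan_sym)
  note st = act_alternating[OF assms(1), where k = n and f = f]
  note ts = act_alternating[OF assms(1)[symmetric], where k = n and f = f, unfolded U cartan_sym[of t s]]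
  note p = chebU_period[OF assms]
  consider "r = s" | "r = t" | "r \<noteq> s" "r \<noteq> t" by blast
  then show "act (alternating s t n) f r = act (alternating t s n) f r"
  proof cases
    case 1
    then show ?thesis using st(1,2) ts(1,2) p by (cases "even n") auto
  next
    case 2
    then show ?thesis using st(1,2) ts(1,2) p by (cases "even n") auto
  next
    case 3
    have z: "(if even n then ?U n * b else - ?U n * a) = 0" for a b
      using p(1) by simp
    have "(\<Sum>j<n. if even j then ?U (Suc j) * a + ?U j * b else 0) =
        (\<Sum>j<n. if even j then 0 else ?U (Suc j) * b + ?U j * a)" for a b
      using sum_alternating_parity[of ?U, where k = n and a = a and b = b, OF chebU.simps(1)] unfolding z by (simp only: add_0_right)
    then show ?thesis
      unfolding st(3)[OF 3] ts(3)[OF 3(2,1)] by (simp only: diff_right_commute)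
  qed
qed

subsection \<open>Words up to equality in the Coxeter group\<close>

text \<open>
  Recording the parity of the length makes the sign character available before the representation
  is known to be faithful.
\<close>

definition eqw :: "'a list \<Rightarrow> 'a list \<Rightarrow> bool" (infix "\<approx>" 50) where
  "x \<approx> y \<longleftrightarrow> act x = act y \<and> even (length x) = even (length y)"

text \<open>\<open>pos x s\<close> and \<open>neg x s\<close>: the root \<open>x \<alpha>\<^sub>s\<close> is positive, respectively negative.\<close>

definition pos :: "'a list \<Rightarrow> 'a \<Rightarrow> bool" where
  "pos x s \<longleftrightarrow> (\<forall>f. (\<forall>r. 0 \<le> f r) \<longrightarrow> 0 \<le> act x f s)"

definition neg :: "'a list \<Rightarrow> 'a \<Rightarrow> bool" where
  "neg x s \<longleftrightarrow> (\<forall>f. (\<forall>r. 0 \<le> f r) \<longrightarrow> act x f s \<le> 0)"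

definition reduced :: "'a list \<Rightarrow> bool" where
  "reduced x \<longleftrightarrow> (\<forall>y. y \<approx> x \<longrightarrow> length x \<le> length y)"

lemma eqw_refl [simp]: "x \<approx> x"
  by (simp add: eqw_def)

lemma eqw_sym: "x \<approx> y \<Longrightarrow> y \<approx> x"
  by (auto simp: eqw_def)

lemma eqw_trans [trans]: "x \<approx> y \<Longrightarrow> y \<approx> z \<Longrightarrow> x \<approx> z"
  by (auto simp: eqw_def)

lemma eqw_append: "x \<approx> x' \<Longrightarrow> y \<approx> y' \<Longrightarrow> x @ y \<approx> x' @ y'"
  by (simp add: eqw_def fun_eq_iff[of "act (_ @ _)"])

lemma eqw_rev:
  assumes "x \<approx> y" shows "rev x \<approx> rev y"
proof -
  have "act (rev x) f = act (rev y) f" for f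
    using assms act_rev(1)[of x "act (rev y) f"] by (simp add: eqw_def)
  then show ?thesis using assms by (auto simp: eqw_def)
qed

lemma eqw_cancel: "x @ [s, s] @ y \<approx> x @ y"
  by (simp add: eqw_def fun_eq_iff)

lemma eqw_snoc_iff: "x @ [s] \<approx> y \<longleftrightarrow> x \<approx> y @ [s]"
proof -
  have "x \<approx> y @ [s]" if "x @ [s] \<approx> y" for x y
    using eqw_trans[OF eqw_sym[OF eqw_cancel[of x s "[]"]], of "y @ [s]"]
      eqw_append[OF that eqw_refl[of "[s]"]] by simp
  from this[of x y] this[of y x] show ?thesis using eqw_sym by blast
qed

lemma eqw_append_cancel_right: "x @ z \<approx> y @ z \<longleftrightarrow> x \<approx> y"
proof
  assume "x @ z \<approx> y @ z"
  then have "act (rev z) (act (x @ z) f) = act (rev z) (act (y @ z) f)"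
     and "even (length x) = even (length y)" for f
    by (auto simp: eqw_def)
  then show "x \<approx> y" by (simp add: eqw_def fun_eq_iff)
qed (simp add: eqw_append)

lemma eqw_append_cancel_left: "z @ x \<approx> z @ y \<longleftrightarrow> x \<approx> y"
proof
  assume "z @ x \<approx> z @ y"
  from eqw_rev[OF this] have "rev x \<approx> rev y" by (simp add: eqw_append_cancel_right)
  from eqw_rev[OF this] show "x \<approx> y" by simp
qed (rule eqw_append[OF eqw_refl])

lemma eqw_braid: "s \<noteq> t \<Longrightarrow> m s t = enat n \<Longrightarrow> alternating s t n \<approx> alternating t s n"
  unfolding eqw_def by (intro conjI act_braid) simp_all

lemma pos_cong: "x \<approx> y \<Longrightarrow> pos x = pos y"
  unfolding eqw_def pos_def by simp

lemma neg_cong: "x \<approx> y \<Longrightarrow> neg x = neg y"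
  unfolding eqw_def neg_def by simp

lemma pos_Nil [simp]: "pos [] s"
  by (simp add: pos_def)

lemma neg_snoc: "neg (x @ [s]) s = pos x s"
  by (simp add: pos_def neg_def)

text \<open>Every form is the difference of its positive and negative parts, so vanishing at a root
  can be tested on nonnegative forms. \<open>P\<close> allows a further restriction to forms that
  vanish at a chosen simple root.\<close>

lemma act_decomp_nonneg:
  assumes "\<And>f. (\<forall>r. 0 \<le> f r) \<Longrightarrow> P f \<Longrightarrow> act x f s = 0"
    and "P (\<lambda>r. max (f r) 0)" "P (\<lambda>r. max (- f r) 0)"
  shows "act x f s = 0"
proof -
  have "f = (\<lambda>r. 1 * max (f r) 0 + (-1) * max (- f r) 0)" by (auto simp: fun_eq_iff max_def)
  from arg_cong[OF this, of "\<lambda>f. act x f s"]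
  have "act x f s = 1 * act x (\<lambda>r. max (f r) 0) s + (-1) * act x (\<lambda>r. max (- f r) 0) s"
    by (simp only: act_lincomb)
  then show ?thesis using assms by simp
qed

lemma not_pos_neg: "\<not> (pos x s \<and> neg x s)"
proof
  assume a: "pos x s \<and> neg x s"
  \<comment> \<open>A root of both signs would be killed by every form, but this form takes the
    value 1 there.\<close>
  have "act x (act (rev x) (\<lambda>r. 1)) s = 0"
    by (rule act_decomp_nonneg[where P = "\<lambda>_. True"]) (use a in \<open>auto simp: pos_def neg_def intro: antisym\<close>)
  then show False by simp
qed

section \<open>Reduced words, dihedral factors and signs of roots\<close>

lemma reducedD: "reduced x \<Longrightarrow> y \<approx> x \<Longrightarrow> length x \<le> length y"
  by (simp add: reduced_def)

lemma reduced_eqw: "reduced x \<Longrightarrow> y \<approx> x \<Longrightarrow> length y \<le> length x \<Longrightarrow> reduced y"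
  unfolding reduced_def using eqw_trans by fastforce

lemma ex_reduced: "\<exists>y. reduced y \<and> y \<approx> x"
proof -
  obtain y where "y \<approx> x" "\<And>z. z \<approx> x \<Longrightarrow> length y \<le> length z"
    using ex_has_least_nat[of "\<lambda>y. y \<approx> x" x length] by auto
  then show ?thesis unfolding reduced_def using eqw_trans by blast
qed

lemma reduced_infix:
  assumes "reduced (x @ y @ z)" shows "reduced y"
  unfolding reduced_def
proof (intro allI impI)
  fix y' assume "y' \<approx> y"
  then have "x @ y' @ z \<approx> x @ y @ z" by (simp add: eqw_append)
  from reducedD[OF assms this] show "length y \<le> length y'" by simp
qed

lemma reduced_prefix: "reduced (x @ y) \<Longrightarrow> reduced x"
  using reduced_infix[of "[]" x y] by simp

lemma reduced_suffix: "reduced (x @ y) \<Longrightarrow> reduced y"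
  using reduced_infix[of x y "[]"] by simp

lemma not_reduced_square: "\<not> reduced (x @ [s, s] @ y)"
  using reducedD[OF _ eqw_sym[OF eqw_cancel]] by fastforce

lemma reduced_Nil [simp]: "reduced []"
  by (simp add: reduced_def)

lemma not_reduced_snoc:
  assumes "reduced x" "\<not> reduced (x @ [s])"
  obtains y where "y \<approx> x @ [s]" "length x = Suc (length y)" "reduced (y @ [s])" "y @ [s] \<approx> x"
proof -
  obtain y where y: "y \<approx> x @ [s]" "length y < Suc (length x)"
    using assms(2) by (auto simp: reduced_def not_le)
  have yx: "y @ [s] \<approx> x" using y(1) eqw_snoc_iff by blast
  \<comment> \<open>The parity recorded in \<open>eqw\<close> excludes equal lengths, so the length
    drops by exactly one.\<close>
  have "even (length y) = odd (length x)" using y(1) by (simp add: eqw_def)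
  then have "length y \<noteq> length x" by auto
  then have "length x = Suc (length y)"
    using reducedD[OF assms(1) yx] y(2) by simp
  then show ?thesis using that y(1) yx reduced_eqw[OF assms(1) yx] by simp
qed

text \<open>Take \<open>v\<close> as short as possible, the minimal representative of the left coset
  of the dihedral subgroup: if \<open>s\<close> or \<open>t\<close> were a descent of
  \<open>v\<close>, that letter could be moved into \<open>u\<close>.\<close>

lemma dihedral_decomposition:
  assumes "reduced x"
  obtains v u where "x \<approx> v @ u" "set u \<subseteq> {s, t}" "length v + length u = length x"
    "reduced (v @ [s])" "reduced (v @ [t])"
proof -
  let ?P = "\<lambda>v. \<exists>u. x \<approx> v @ u \<and> set u \<subseteq> {s, t} \<and> length v + length u = length x"
  have "?P x" by (intro exI[of _ "[]"]) simp
  then obtain v where v: "?P v" and min: "\<And>v'. ?P v' \<Longrightarrow> length v \<le> length v'"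
    using ex_has_least_nat[of ?P x length] by auto
  then obtain u where u: "x \<approx> v @ u" "set u \<subseteq> {s, t}" "length v + length u = length x" by blast
  have vu: "reduced (v @ u)" using reduced_eqw[OF assms eqw_sym[OF u(1)]] u(3) by simp
  have "reduced (v @ [a])" if a: "a \<in> {s, t}" for a
  proof (rule ccontr)
    assume "\<not> reduced (v @ [a])"
    then obtain y where y: "length v = Suc (length y)" "y @ [a] \<approx> v"
      using not_reduced_snoc reduced_prefix[OF vu] by metis
    have "x \<approx> y @ a # u"
      using eqw_trans[OF u(1) eqw_append[OF eqw_sym[OF y(2)] eqw_refl[of u]]] by simp
    then have "?P y" using a u y by (intro exI[of _ "a # u"]) auto
    from min[OF this] y show False by simp
  qed
  then show ?thesis using that u by blast
qed

lemma reduced_dihedral_alternating: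
  assumes "reduced u" "set u \<subseteq> {s, t}" "length u = k"
  shows "u = alternating s t k \<or> u = alternating t s k"
  using assms
proof (induction u arbitrary: k)
  case (Cons a u)
  have r: "reduced u" using Cons.prems(1) reduced_suffix[of "[a]" u] by simp
  obtain k' where k: "k = Suc k'" "length u = k'" using Cons.prems(3) by auto
  have IH: "u = alternating s t k' \<or> u = alternating t s k'"
    using Cons.IH[OF r _ k(2)] Cons.prems(2) by auto
  have "u = alternating b c j \<Longrightarrow> j = 0 \<or> a \<noteq> b" for b c j
    using Cons.prems(1) not_reduced_square[of "[]" a] by (cases j) auto
  from this[of s t k'] this[of t s k'] show ?case using IH k Cons.prems(2) by fastforce
qed simp

lemma alternating_add: "\<exists>z. alternating s t (j + k) = alternating s t j @ z"
  by (induction k) (auto simp del: alternating.simps(2) simp: alternating_snoc)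

text \<open>A longer alternating word begins with \<open>s\<close> followed by one side of the braid
  relation; the other side begins with \<open>s\<close> as well, which creates a square.\<close>

lemma reduced_alternating_le:
  assumes "reduced (alternating s t k)" "s \<noteq> t"
  shows "enat k \<le> m s t"
proof (rule ccontr)
  assume "\<not> enat k \<le> m s t"
  then obtain n where n: "m s t = enat n" "n < k" by (cases "m s t") auto
  have "Suc n + (k - Suc n) = k" using n(2) by simp
  then obtain z where z: "alternating s t k = alternating s t (Suc n) @ z"
    using alternating_add[of s t "Suc n" "k - Suc n"] by metis
  have r: "reduced ([s] @ alternating t s n)"
    using reduced_prefix[OF assms(1)[unfolded z]] by simp
  obtain i where i: "n = Suc i" using m_ge2[OF assms(2)] n by (cases n) (auto simp: numeral_eq_enat)
  have "[s] @ alternating s t n \<approx> [s] @ alternating t s n"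
    by (intro eqw_append eqw_refl eqw_braid assms n)
  from reduced_eqw[OF r this] have "reduced ([s] @ alternating s t n)" by simp
  then show False using not_reduced_square[of "[]" s "alternating t s i"] by (simp add: i)
qed

lemma pos_alternating:
  assumes "a \<noteq> b" "enat (Suc k) \<le> m a b" "pos v a" "pos v b"
  shows "pos (v @ alternating a b k) (if even k then a else b)"
proof -
  have "enat k \<le> m a b" by (rule order.trans[OF _ assms(2)]) simp
  then have "0 \<le> chebU (- cartan a b) k" "0 \<le> chebU (- cartan a b) (Suc k)"
    using assms chebU_nonneg by blast+
  then show ?thesis
    using assms(3,4) act_alternating(1)[OF assms(1), of k] by (simp add: pos_def del: chebU.simps)
qed

text \<open>Induction on the length: factor \<open>x\<close> as \<open>v u\<close> with
  \<open>u\<close> dihedral and \<open>v\<close> shorter. Then \<open>v\<close> keeps both simple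
  roots positive, and since \<open>u s\<close> is a reduced alternating word, \<open>u\<close> maps
  \<open>\<alpha>\<^sub>s\<close> to a nonnegative combination of these two roots.\<close>

lemma reduced_snoc_imp_pos: "reduced (x @ [s]) \<Longrightarrow> pos x s"
proof (induction "length x" arbitrary: x s rule: less_induct)
  case less
  show ?case
  proof (cases x rule: rev_cases)
    case (snoc x1 t)
    have ts: "t \<noteq> s" using less.prems not_reduced_square[of x1 s "[]"] snoc by auto
    have rx: "reduced x" using less.prems reduced_prefix by blast
    obtain v u where vu: "x \<approx> v @ u" "set u \<subseteq> {s, t}" "length v + length u = length x"
      "reduced (v @ [s])" "reduced (v @ [t])"
      using dihedral_decomposition[OF rx] by blast
    have "u \<noteq> []"
    proof
      assume "u = []"
      then have "x1 \<approx> v @ [t]" using vu(1) snoc eqw_snoc_iff by simp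
      from reducedD[OF vu(5) this] show False using vu(3) snoc \<open>u = []\<close> by simp
    qed
    then have l: "length v < length x" using vu(3) by (cases u) auto
    have p: "pos v s" "pos v t" using less.hyps[OF l] vu(4,5) by blast+
    have "v @ u @ [s] \<approx> x @ [s]" using eqw_append[OF eqw_sym[OF vu(1)] eqw_refl[of "[s]"]] by simp
    from reduced_eqw[OF less.prems this] have "reduced (v @ u @ [s])" using vu(3) by simp
    then have r: "reduced (u @ [s])" using reduced_suffix by blast
    moreover have "set (u @ [s]) \<subseteq> {s, t}" using vu(2) by auto
    ultimately obtain a b where ab: "{a, b} = {s, t}" "u @ [s] = alternating a b (Suc (length u))"
      using reduced_dihedral_alternating[OF r _ HOL.refl] by (metis insert_commute length_append_singleton)
    have "a \<noteq> b" using ab(1) ts by force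
    have "enat (Suc (length u)) \<le> m a b"
      using reduced_alternating_le[OF _ \<open>a \<noteq> b\<close>] r ab(2) by simp
    moreover have "pos v a" "pos v b" using p ab(1) by (metis insertI1 insertCI insertE singletonD)+
    ultimately have "pos (v @ u) s"
      using pos_alternating[OF \<open>a \<noteq> b\<close>, of "length u" v] ab(2) unfolding alternating_snoc by auto
    then show ?thesis using pos_cong[OF vu(1)] by simp
  qed simp
qed

text \<open>Pass to a reduced word: either appending \<open>s\<close> keeps it reduced, or it can be
  rewritten to end in \<open>s\<close>, which flips the sign.\<close>

lemma pos_or_neg: "pos x s \<or> neg x s"
proof -
  obtain y where y: "reduced y" "y \<approx> x" using ex_reduced by blast
  show ?thesis
  proof (cases "reduced (y @ [s])")
    case True
    then show ?thesis using reduced_snoc_imp_pos[OF True] pos_cong[OF y(2)] by simp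
  next
    case False
    obtain z where z: "reduced (z @ [s])" "z @ [s] \<approx> y" by (rule not_reduced_snoc[OF y(1) False])
    have "neg (z @ [s]) s" using reduced_snoc_imp_pos[OF z(1)] by (simp add: neg_snoc)
    then show ?thesis using neg_cong[OF eqw_trans[OF z(2) y(2)]] by simp
  qed
qed

lemma not_pos_iff: "\<not> pos x s \<longleftrightarrow> neg x s"
  using pos_or_neg not_pos_neg by blast

lemma reduced_snoc_iff:
  assumes "reduced x" shows "reduced (x @ [s]) \<longleftrightarrow> pos x s"
proof
  assume p: "pos x s"
  show "reduced (x @ [s])"
  proof (rule ccontr)
    assume n: "\<not> reduced (x @ [s])"
    obtain z where z: "reduced (z @ [s])" "z @ [s] \<approx> x" by (rule not_reduced_snoc[OF assms n])
    have "neg (z @ [s]) s" using reduced_snoc_imp_pos[OF z(1)] by (simp add: neg_snoc)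
    then show False using p neg_cong[OF z(2)] not_pos_neg by simp
  qed
qed (rule reduced_snoc_imp_pos)

section \<open>From sign changes of roots to the exchange condition\<close>

lemma simple_root_if_sign_change:
  assumes "pos x t" "neg (s # x) t"
  obtains c where "0 < c" "\<And>f. act x f t = c * f s"
proof -
  let ?e = "\<lambda>r. of_bool (r = s) :: real"
  \<comment> \<open>Forms vanishing at \<open>s\<close> are fixed by the reflection, so the
    nonnegative ones among them are both nonnegative and nonpositive at this root.\<close>
  have z: "act x f t = 0" if "f s = 0" for f
  proof (rule act_decomp_nonneg[where P = "\<lambda>f. f s = 0"])
    fix f :: "'a \<Rightarrow> real" assume f: "\<forall>r. 0 \<le> f r" "f s = 0"
    have "fire s f = f" using f(2) by (simp add: fire_def)
    then show "act x f t = 0"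
      using assms f(1) unfolding pos_def neg_def by (intro antisym) (auto dest!: spec[of _ f])
  qed (use that in auto)
  \<comment> \<open>Subtracting a multiple of the coordinate form \<open>?e\<close> leaves a form
    that vanishes at \<open>s\<close>.\<close>
  have e: "act x f t = act x ?e t * f s" for f
    using z[of "\<lambda>r. f r - f s * ?e r"] act_diff_scaled[of x f "f s" ?e] by simp
  have "0 \<le> act x ?e t" using assms(1) by (auto simp: pos_def)
  moreover have "act x ?e t \<noteq> 0"
    using e[of "act (rev x) (\<lambda>r. 1)"] by auto
  ultimately show ?thesis using that[OF _ e] by simp
qed

text \<open>The conjugate of \<open>t\<close> by \<open>x\<close> and the generator \<open>s\<close>
  are reflections with proportional roots: on forms, the first subtracts \<open>f s\<close> times
  \<open>h\<close>, the second \<open>f s\<close> times \<open>cartan s\<close>. So the claim is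
  that the difference \<open>d\<close> of these two rows vanishes.\<close>

lemma simple_root_conjugation:
  assumes c: "\<And>f. act x f t = c * f s"
  shows "[s] @ x \<approx> x @ [t]"
proof -
  define h where "h = (\<lambda>r. c * act (rev x) (cartan t) r)"
  define d where "d = (\<lambda>r. cartan s r - h r)"
  have hs: "h s = 2"
    using c[of "act (rev x) (cartan t)"] by (simp add: h_def)
  have fire_eq: "fire r f = (\<lambda>q. f q - f r * cartan r q)" for r f
    by (simp add: fire_def mult.commute)
  have refl: "act (x @ [t] @ rev x) f = (\<lambda>q. f q - f s * h q)" for f
  proof -
    have "fire t (act x f) = (\<lambda>q. act x f q - (c * f s) * cartan t q)" by (simp only: fire_eq c)
    then show ?thesis
      by (simp only: act_append act_simps act_diff_scaled act_rev) (simp add: h_def mult_ac)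
  qed
  let ?z = "x @ [t] @ rev x @ [s]"
  have z: "act ?z f = (\<lambda>q. f q + f s * d q)" for f
  proof -
    have "act ?z f = fire s (act (x @ [t] @ rev x) f)" by simp
    then show ?thesis
      unfolding refl by (simp add: fire_eq[of s] d_def hs fun_eq_iff algebra_simps)
  qed
  have ds: "d s = 0" using hs by (simp add: d_def)
  have z': "act (rev ?z) f = (\<lambda>q. f q - f s * d q)" for f
  proof -
    have "act ?z (\<lambda>q. f q - f s * d q) = f" using ds by (simp only: z) (simp add: fun_eq_iff)
    then show ?thesis using act_rev(1)[of ?z "\<lambda>q. f q - f s * d q"] by simp
  qed
  \<comment> \<open>\<open>z\<close> is unipotent; if it were not trivial, \<open>z\<close> or its inverse would map \<open>\<alpha>\<^sub>r\<close> to a root with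
    coefficients of both signs.\<close>
  have "d r = 0" for r
  proof (cases "r = s")
    case False
    let ?e = "\<lambda>a q. of_bool (q = a) :: real"
    have v: "act ?z (?e r) r = 1" "act ?z (?e s) r = d r"
      "act (rev ?z) (?e r) r = 1" "act (rev ?z) (?e s) r = - d r"
      using False by (simp_all only: z z') auto
    have "pos y r" if "act y (?e r) r = 1" for y
    proof -
      have "\<not> neg y r" unfolding neg_def using that by (auto intro!: exI[of _ "?e r"])
      then show ?thesis using pos_or_neg by blast
    qed
    then have "pos ?z r" "pos (rev ?z) r" using v by blast+
    then have "0 \<le> act ?z (?e s) r" "0 \<le> act (rev ?z) (?e s) r" by (auto simp only: pos_def of_bool_def) auto
    then show ?thesis using v by simp
  qed (simp add: ds)
  then have "act ?z f = f" for f by (simp only: z) simp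
  moreover have "act ([s] @ x) (act ?z f) = act (x @ [t]) f" for f by simp
  ultimately have "act ([s] @ x) f = act (x @ [t]) f" for f by metis
  then show ?thesis unfolding eqw_def by (intro conjI HOL.ext) simp_all
qed

text \<open>Induction on the first letter: either the rest \<open>x\<close> already makes
  \<open>\<alpha>\<^sub>t\<close> negative, or the sign changes at the first letter
  \<open>s\<close>. Then \<open>x\<close> maps \<open>\<alpha>\<^sub>t\<close> to a multiple of
  \<open>\<alpha>\<^sub>s\<close>, so \<open>s x = x t\<close> and \<open>s x t\<close> collapses to
  \<open>x\<close>.\<close>

lemma exchange:
  assumes "neg x t"
  shows "\<exists>i<length x. x @ [t] \<approx> take i x @ drop (Suc i) x"
  using assms
proof (induction x)
  case Nil
  then show ?case using not_pos_neg[of "[]" t] by simp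
next
  case (Cons s x)
  show ?case
  proof (cases "neg x t")
    case True
    then obtain i where "i < length x" "x @ [t] \<approx> take i x @ drop (Suc i) x" using Cons by blast
    then show ?thesis using eqw_append[OF eqw_refl[of "[s]"]] by (intro exI[of _ "Suc i"]) simp
  next
    case False
    then have "pos x t" using not_pos_iff by blast
    then obtain c where "\<And>f. act x f t = c * f s"
      using Cons.prems simple_root_if_sign_change by metis
    then have "[s] @ x \<approx> x @ [t]" by (rule simple_root_conjugation)
    then have "[s] @ x @ [t] \<approx> [s] @ [s] @ x" using eqw_append_cancel_left eqw_sym by blast
    also have "[s] @ [s] @ x \<approx> x" using eqw_cancel[of "[]" s x] by simp
    finally show ?thesis by (intro exI[of _ 0]) simp
  qed
qed

subsection \<open>Matsumoto's theorem\<close>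

text \<open>Squares of letters are not cancelled here: only relations that also hold between the
  positive generators of the Artin group are allowed.\<close>

inductive braid :: "'a list \<Rightarrow> 'a list \<Rightarrow> bool" where
  rel: "s \<noteq> t \<Longrightarrow> m s t = enat n \<Longrightarrow> braid (alternating s t n) (alternating t s n)"
| refl: "braid x x"
| trans [trans]: "braid x y \<Longrightarrow> braid y z \<Longrightarrow> braid x z"
| app: "braid x x' \<Longrightarrow> braid y y' \<Longrightarrow> braid (x @ y) (x' @ y')"

lemma set_alternating: "2 \<le> n \<Longrightarrow> set (alternating s t n) = {s, t}"
proof -
  have sub: "set (alternating a b k) \<subseteq> {a, b}" for a b k
    by (induction a b k rule: alternating.induct) auto
  assume "2 \<le> n"
  then obtain k where "n = Suc (Suc k)" by (metis Suc_le_D numeral_2_eq_2 Suc_le_mono)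
  then show ?thesis using sub[of s t k] by auto
qed

lemma braid_set: "braid x y \<Longrightarrow> set x = set y"
proof (induction rule: braid.induct)
  case (rel s t n)
  then have "2 \<le> n" using m_ge2[of s t] by (simp add: numeral_eq_enat)
  then show ?case by (simp add: set_alternating insert_commute)
qed auto

text \<open>Induction on the length. Equal last letters cancel. If the last letters are
  \<open>s\<close> and \<open>t\<close>, both are descents, so the dihedral factor \<open>u\<close>
  has full length and can be written as \<open>p s\<close> and as \<open>q t\<close>. The chain
  \<open>x' s\<close>, \<open>v p s\<close>, \<open>v q t\<close>, \<open>y' t\<close> uses the
  induction hypothesis at both ends and one braid relation in the middle.\<close>

lemma matsumoto: "reduced x \<Longrightarrow> reduced y \<Longrightarrow> x \<approx> y \<Longrightarrow> braid x y"
proof (induction "length x" arbitrary: x y rule: less_induct)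
  case less
  have len: "length x = length y"
    using less.prems reducedD eqw_sym by (metis le_antisym)
  show ?case
  proof (cases x rule: rev_cases)
    case Nil
    then show ?thesis using len by (simp add: braid.refl)
  next
    case x: (snoc x' s)
    then obtain y' t where y: "y = y' @ [t]" using len by (cases y rule: rev_cases) auto
    have rx: "reduced x'" and ry: "reduced y'" using less.prems x y reduced_prefix by blast+
    show ?thesis
    proof (cases "s = t")
      case True
      then have "x' \<approx> y'" using less.prems(3) x y eqw_append_cancel_right by blast
      then have "braid x' y'" using less.hyps[OF _ rx ry] x by simp
      then show ?thesis using x y True by (simp add: braid.app braid.refl)
    next
      case st: False
      obtain v u where vu: "x \<approx> v @ u" "set u \<subseteq> {s, t}" "length v + length u = length x"
        "reduced (v @ [s])" "reduced (v @ [t])"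
        using dihedral_decomposition[OF less.prems(1)] by blast
      have rvu: "reduced (v @ u)" using reduced_eqw[OF less.prems(1) eqw_sym[OF vu(1)]] vu(3) by simp
      obtain a b where ab: "{a, b} = {s, t}" "u = alternating a b (length u)"
        using reduced_dihedral_alternating[OF reduced_suffix[OF rvu] vu(2) HOL.refl] by blast
      have "a \<noteq> b" using ab(1) st by force
      have "neg x s" "neg y t"
        using less.prems(1,2) reduced_snoc_imp_pos neg_snoc x y by blast+
      then have neg: "neg (v @ u) c" if "c \<in> {s, t}" for c
        using that neg_cong[OF vu(1)] neg_cong[OF less.prems(3)] by auto
      have pab: "pos v a" "pos v b"
        using ab(1) vu(4,5) reduced_snoc_imp_pos by (metis insertI1 insertCI insertE singletonD)+
      have le: "enat (length u) \<le> m a b"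
        using reduced_alternating_le[OF _ \<open>a \<noteq> b\<close>] reduced_suffix[OF rvu] ab(2) by metis
      \<comment> \<open>Otherwise the letter that continues the alternating word \<open>u\<close>
        would be an ascent of \<open>v u\<close>, although \<open>s\<close> and \<open>t\<close> are
        both descents.\<close>
      have "\<not> enat (Suc (length u)) \<le> m a b"
      proof
        let ?c = "if even (length u) then a else b"
        assume "enat (Suc (length u)) \<le> m a b"
        from pos_alternating[OF \<open>a \<noteq> b\<close> this pab] have "pos (v @ u) ?c" using ab(2) by simp
        moreover have "neg (v @ u) ?c" using neg ab(1) by auto
        ultimately show False using not_pos_neg by blast
      qed
      then have mab: "m a b = enat (length u)" using le by (cases "m a b") auto
      have ends: "\<exists>p q. {alternating a b n, alternating b a n} = {p @ [s], q @ [t]}"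
        if "n = Suc k" for n k
      proof -
        have "(a = s \<and> b = t) \<or> (a = t \<and> b = s)" using ab(1) by (auto simp: doubleton_eq_iff)
        then show ?thesis unfolding that alternating_snoc by auto
      qed
      obtain k where "length u = Suc k"
        using m_ge2[OF \<open>a \<noteq> b\<close>] mab by (cases "length u") (auto simp: numeral_eq_enat)
      then obtain p q where pq: "{u, alternating b a (length u)} = {p @ [s], q @ [t]}"
        using ends ab(2) by metis
      have bu: "braid u (alternating b a (length u))" "braid (alternating b a (length u)) u"
        using braid.rel[OF \<open>a \<noteq> b\<close> mab] braid.rel[OF \<open>a \<noteq> b\<close>[symmetric], of "length u"] mab m_sym ab(2) by auto
      have eu: "alternating b a (length u) \<approx> u"
        using eqw_braid[OF \<open>a \<noteq> b\<close>[symmetric], of "length u"] mab m_sym ab(2) by metis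
      have bpq: "braid (p @ [s]) (q @ [t])"
        using pq bu by (auto simp: doubleton_eq_iff)
      have up: "u \<approx> p @ [s]" and uq: "u \<approx> q @ [t]"
        using pq eqw_sym[OF eu] by (auto simp: doubleton_eq_iff)
      have lp: "length u = Suc (length p)" and lq: "length u = Suc (length q)"
      proof -
        have "\<forall>w\<in>{u, alternating b a (length u)}. length w = length u" by simp
        then show "length u = Suc (length p)" "length u = Suc (length q)" unfolding pq by simp_all
      qed
      have "x \<approx> v @ p @ [s]" "x \<approx> v @ q @ [t]"
        using eqw_trans[OF vu(1) eqw_append[OF eqw_refl[of v]]] up uq by blast+
      then have "x' @ [s] \<approx> (v @ p) @ [s]" "y' @ [t] \<approx> (v @ q) @ [t]"
        using x y eqw_trans[OF eqw_sym[OF less.prems(3)]] by simp_all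
      then have vp: "x' \<approx> v @ p" and vq: "y' \<approx> v @ q"
        unfolding eqw_append_cancel_right by blast+
      have "braid x' (v @ p)"
        using less.hyps[OF _ rx _ vp] reduced_eqw[OF rx eqw_sym[OF vp]] x vu(3) lp by simp
      moreover have "reduced (v @ q)"
        using reduced_eqw[OF ry eqw_sym[OF vq]] y len vu(3) lq by simp
      then have "braid (v @ q) y'"
        using less.hyps[OF _ _ ry eqw_sym[OF vq]] len vu(3) lq by simp
      ultimately have "braid (x' @ [s]) (v @ p @ [s])" "braid (v @ q @ [t]) (y' @ [t])"
        using braid.app[OF _ braid.refl] by fastforce+
      moreover have "braid (v @ p @ [s]) (v @ q @ [t])" using braid.app[OF braid.refl bpq] .
      ultimately show ?thesis using x y braid.trans by blast
    qed
  qed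
qed

subsection \<open>Minimal coset representatives and the retraction\<close>

text \<open>\<open>x\<close> is the shortest element of \<open>W\<^sub>T x\<close>.\<close>

definition minimal :: "'a set \<Rightarrow> 'a list \<Rightarrow> bool" where
  "minimal T x \<longleftrightarrow> (\<forall>t\<in>T. pos (rev x) t)"

text \<open>A loop at the coset of \<open>x\<close> in the Schreier graph: right multiplication by
  \<open>s\<close> fixes the coset, and \<open>t\<close> is the correction on the left.\<close>

definition loops :: "'a set \<Rightarrow> 'a list \<Rightarrow> 'a \<Rightarrow> 'a \<Rightarrow> bool" where
  "loops T x s t \<longleftrightarrow> t \<in> T \<and> x @ [s] \<approx> [t] @ x"

definition loop :: "'a set \<Rightarrow> 'a list \<Rightarrow> 'a \<Rightarrow> 'a option" where
  "loop T x s = (if \<exists>t. loops T x s t then Some (THE t. loops T x s t) else None)"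

text \<open>The sign travels with the letter; both signs move the state alike because the generators
  of the Coxeter group are involutions. The state is a word that is only ever extended, and by
  \<open>out_cong\<close> its class alone matters.\<close>

fun out :: "'a set \<Rightarrow> 'a list \<Rightarrow> ('a \<times> 'b) list \<Rightarrow> ('a \<times> 'b) list" where
  "out T x [] = []"
| "out T x ((s, b) # w) =
    (case loop T x s of None \<Rightarrow> out T (x @ [s]) w | Some t \<Rightarrow> (t, b) # out T x w)"

fun endpt :: "'a set \<Rightarrow> 'a list \<Rightarrow> ('a \<times> 'b) list \<Rightarrow> 'a list" where
  "endpt T x [] = x"
| "endpt T x ((s, b) # w) =
    (case loop T x s of None \<Rightarrow> endpt T (x @ [s]) w | Some t \<Rightarrow> endpt T x w)"

lemma eqw_letter: "[s] \<approx> [t] \<Longrightarrow> s = t"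
proof (rule ccontr)
  assume "[s] \<approx> [t]" "s \<noteq> t"
  then have "fire s f = fire t f" for f by (simp add: eqw_def fun_eq_iff)
  from fun_cong[OF this[of "\<lambda>r. of_bool (r = s)"], of s] show False
    using \<open>s \<noteq> t\<close> by (simp add: fire_def)
qed

lemma loops_unique: "loops T x s t \<Longrightarrow> loops T x s t' \<Longrightarrow> t = t'"
  unfolding loops_def by (metis eqw_append_cancel_right eqw_letter eqw_sym eqw_trans)

lemma loop_eq_Some_iff: "loop T x s = Some t \<longleftrightarrow> loops T x s t"
proof -
  have "(THE t. loops T x s t) = t" if "loops T x s t" for t
    using that loops_unique by (intro the_equality) auto
  then show ?thesis unfolding loop_def by (metis option.distinct(1) option.inject)
qed

lemma loop_eq_None_iff: "loop T x s = None \<longleftrightarrow> (\<forall>t. \<not> loops T x s t)"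
  by (simp add: loop_def)

lemma loops_cong:
  assumes "x \<approx> x'" shows "loops T x s t = loops T x' s t"
proof -
  have "x @ [s] \<approx> x' @ [s]" "[t] @ x \<approx> [t] @ x'"
    using assms by (simp_all add: eqw_append_cancel_right eqw_append_cancel_left del: append.simps)
  then show ?thesis unfolding loops_def by (meson eqw_sym eqw_trans)
qed

lemma loop_cong:
  assumes "x \<approx> x'" shows "loop T x s = loop T x' s"
proof -
  have "loops T x s = loops T x' s" using loops_cong[OF assms] by (intro HOL.ext)
  then show ?thesis by (simp add: loop_def)
qed

lemma minimal_cong: "x \<approx> x' \<Longrightarrow> minimal T x = minimal T x'"
  unfolding minimal_def using pos_cong[OF eqw_rev[of x x']] by simp

lemma minimal_Nil [simp]: "minimal T []"
  by (simp add: minimal_def)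

text \<open>If \<open>x s\<close> is not minimal, then some \<open>\<alpha>\<^sub>t\<close> with
  \<open>t \<in> T\<close> is kept positive by the inverse of \<open>x\<close> and made negative by
  the further reflection \<open>s\<close>. Its image is then a multiple of
  \<open>\<alpha>\<^sub>s\<close>, which yields a loop.\<close>

lemma minimal_snoc:
  assumes "minimal T x" "loop T x s = None"
  shows "minimal T (x @ [s])"
  unfolding minimal_def
proof
  fix t assume t: "t \<in> T"
  show "pos (rev (x @ [s])) t"
  proof (rule ccontr)
    assume "\<not> pos (rev (x @ [s])) t"
    then have "neg (s # rev x) t" by (simp add: not_pos_iff)
    moreover have "pos (rev x) t" using assms(1) t by (simp add: minimal_def)
    ultimately obtain c where "\<And>f. act (rev x) f t = c * f s"
      using simple_root_if_sign_change by blast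
    then have "[s] @ rev x \<approx> rev x @ [t]" by (rule simple_root_conjugation)
    from eqw_rev[OF this] have "loops T x s t" by (simp add: loops_def t)
    then show False using assms(2) loop_eq_None_iff by blast
  qed
qed

text \<open>The inverse of \<open>x\<close> keeps \<open>\<alpha>\<^sub>t\<close> positive by
  minimality, while following it by \<open>s\<close> amounts to preceding it by \<open>t\<close> and
  makes the root negative.\<close>

lemma loops_simple_root:
  assumes "minimal T x" "loops T x s t"
  obtains c where "0 < c" "\<And>f. act (rev x) f t = c * f s"
proof -
  have t: "t \<in> T" "x @ [s] \<approx> [t] @ x" using assms(2) by (auto simp: loops_def)
  have p: "pos (rev x) t" using assms(1) t by (simp add: minimal_def)
  have "s # rev x \<approx> rev x @ [t]" using eqw_rev[OF t(2)] by simp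
  then have "neg (s # rev x) t" using neg_cong neg_snoc p by metis
  with p show ?thesis using that simple_root_if_sign_change by blast
qed

lemma out_append: "out T x (u @ v) = out T x u @ out T (endpt T x u) v"
  by (induction T x u rule: out.induct) (auto split: option.splits)

lemma endpt_append: "endpt T x (u @ v) = endpt T (endpt T x u) v"
  by (induction T x u rule: endpt.induct) (auto split: option.splits)

lemma out_cong: "x \<approx> x' \<Longrightarrow> out T x w = out T x' w"
proof (induction T x w arbitrary: x' rule: out.induct)
  case (2 T x s b w)
  have "x @ [s] \<approx> x' @ [s]" using 2(3) by (rule eqw_append) simp
  then show ?case using 2 loop_cong[OF 2(3)] by (auto split: option.splits)
qed simp

lemma endpt_cong: "x \<approx> x' \<Longrightarrow> endpt T x w \<approx> endpt T x' w"
proof (induction T x w arbitrary: x' rule: endpt.induct)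
  case (2 T x s b w)
  have "x @ [s] \<approx> x' @ [s]" using 2(3) by (rule eqw_append) simp
  then show ?case using 2 loop_cong[OF 2(3)] by (auto split: option.splits)
qed simp

lemma endpt_minimal: "minimal T x \<Longrightarrow> minimal T (endpt T x w)"
  by (induction T x w rule: endpt.induct) (auto simp: minimal_snoc split: option.splits)

lemma out_endpt: "x @ map fst w \<approx> map fst (out T x w) @ endpt T x w"
proof (induction T x w rule: out.induct)
  case (2 T x s b w)
  show ?case
  proof (cases "loop T x s")
    case None
    then show ?thesis using 2(1) by simp
  next
    case (Some t)
    then have "x @ [s] \<approx> [t] @ x" using loop_eq_Some_iff loops_def by blast
    then have "(x @ [s]) @ map fst w \<approx> ([t] @ x) @ map fst w" by (rule eqw_append) simp
    also have "\<dots> \<approx> [t] @ map fst (out T x w) @ endpt T x w"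
      using eqw_append[OF eqw_refl[of "[t]"] 2(2)[OF Some]] by simp
    finally show ?thesis using Some by simp
  qed
qed simp

lemma out_letters: "fst ` set (out T x w) \<subseteq> T"
  by (induction T x w rule: out.induct)
    (auto simp: loop_eq_Some_iff loops_def split: option.splits)

lemma out_signs: "snd ` set (out T x w) \<subseteq> snd ` set w"
proof (induction T x w rule: out.induct)
  case (2 T x s b w)
  then show ?case by (cases "loop T x s") auto
qed simp

section \<open>Reducedness of outputs and uniqueness of the coset decomposition\<close>

lemma act_restrict:
  assumes "set z \<subseteq> T" "\<forall>r\<in>T. f r = g r" "t \<in> T"
  shows "act z f t = act z g t"
  using assms
proof (induction z arbitrary: f g)
  case (Cons s z)
  have "\<forall>r\<in>T. fire s f r = fire s g r" using Cons.prems by (simp add: fire_def)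
  then show ?case using Cons by simp
qed simp

text \<open>Words over \<open>T\<close> map the simple roots of \<open>T\<close> to combinations of
  simple roots of \<open>T\<close>, so only the values of the form on \<open>T\<close>
  count.\<close>

lemma neg_restrict:
  assumes "neg z t" "set z \<subseteq> T" "t \<in> T" "\<forall>r\<in>T. 0 \<le> f r"
  shows "act z f t \<le> 0"
proof -
  have "act z f t = act z (\<lambda>r. if r \<in> T then f r else 0) t"
    using assms by (intro act_restrict[of z T]) auto
  also have "\<dots> \<le> 0" using assms by (auto simp: neg_def)
  finally show ?thesis .
qed

lemma minimal_act_nonneg:
  "minimal T x \<Longrightarrow> \<forall>r. 0 \<le> f r \<Longrightarrow> \<forall>r\<in>T. 0 \<le> act (rev x) f r"
  by (auto simp: minimal_def pos_def)

text \<open>Letter by letter: a loop appends \<open>t\<close>, and the output stays reduced exactly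
  when the output so far keeps \<open>\<alpha>\<^sub>t\<close> positive.\<close>

lemma reduced_out:
  assumes "minimal T x"
  shows "reduced (map fst w) \<Longrightarrow> reduced (map fst (out T x w))"
proof (induction w rule: rev_induct)
  case (snoc l w)
  obtain s b where l: "l = (s, b)" by (cases l)
  define x1 where "x1 = endpt T x w"
  define o1 where "o1 = map fst (out T x w)"
  define y1 where "y1 = map fst w"
  have y1: "reduced (y1 @ [s])" using snoc.prems by (simp add: y1_def l)
  have o1: "reduced o1"
    using snoc.IH reduced_prefix[OF y1] by (simp add: y1_def o1_def)
  show ?case
  proof (cases "loop T x1 s")
    case None
    then show ?thesis using o1 by (simp add: l out_append x1_def o1_def)
  next
    case (Some t)
    then have lp: "loops T x1 s t" by (simp add: loop_eq_Some_iff)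
    have "minimal T x1" using assms by (simp add: x1_def endpt_minimal)
    then obtain c where c: "0 < c" "\<And>f. act (rev x1) f t = c * f s"
      using loops_simple_root lp by blast
    have e: "act (x @ y1) g = act (o1 @ x1) g" for g
      using out_endpt[of x w T] by (simp add: eqw_def o1_def x1_def y1_def)
    \<comment> \<open>Since \<open>x y1 = o1 x1\<close>, the root obtained from
      \<open>\<alpha>\<^sub>t\<close> by \<open>o1\<close> and the inverse of \<open>x\<close> also
      arises by the inverse of \<open>x1\<close> and then \<open>y1\<close>; the former step yields
      \<open>c\<close> times \<open>\<alpha>\<^sub>s\<close>.\<close>
    have key: "act o1 (act (rev x) g) t = c * act y1 g s" for g
      using c(2)[of "act (o1 @ x1) (act (rev x) g)"] e[of "act (rev x) g"] by simp
    have "pos o1 t"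
    proof (rule ccontr)
      assume "\<not> pos o1 t"
      then have n: "neg o1 t" by (simp add: not_pos_iff)
      have T: "set o1 \<subseteq> T" "t \<in> T"
        using out_letters[of T x w] lp by (auto simp: o1_def loops_def)
      \<comment> \<open>An inversion in the output is a negative combination of the \<open>\<alpha>\<^sub>t\<close>, \<open>t \<in> T\<close>, which the inverse
        of a minimal \<open>x\<close> keeps negative; so it comes from an inversion in the input.\<close>
      have "neg y1 s"
        unfolding neg_def
      proof (intro allI impI)
        fix g :: "'a \<Rightarrow> real" assume "\<forall>r. 0 \<le> g r"
        from neg_restrict[OF n T minimal_act_nonneg[OF assms this]]
        show "act y1 g s \<le> 0" unfolding key using c(1) by (simp add: mult_le_0_iff)
      qed
      then show False using reduced_snoc_imp_pos[OF y1] not_pos_neg by blast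
    qed
    then have "reduced (o1 @ [t])" using reduced_snoc_iff[OF o1] by simp
    then show ?thesis using Some by (simp add: l out_append x1_def o1_def)
  qed
qed simp

text \<open>A nonempty shortest word over \<open>T\<close> for the inverse of \<open>z\<close> makes
  the root of its last letter negative within the span of \<open>T\<close>. The inverse of
  \<open>x\<close> keeps it negative, against the minimality of \<open>y\<close>.\<close>

lemma minimal_translate_trivial:
  assumes "minimal T x" "minimal T y" "set z \<subseteq> T" "y \<approx> z @ x"
  shows "z \<approx> []"
proof -
  have "set (rev z) \<subseteq> T \<and> rev z \<approx> rev z" using assms(3) by simp
  \<comment> \<open>Shortest among words over \<open>T\<close>: the exchange condition only deletes
    letters, so it stays within this alphabet.\<close>
  then obtain z' where z': "set z' \<subseteq> T" "z' \<approx> rev z"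
    and min: "\<And>u. set u \<subseteq> T \<Longrightarrow> u \<approx> rev z \<Longrightarrow> length z' \<le> length u"
    using ex_has_least_nat[of "\<lambda>u. set u \<subseteq> T \<and> u \<approx> rev z" "rev z" length] by auto
  have "z' = []"
  proof (rule ccontr)
    assume "z' \<noteq> []"
    then obtain z1 t where z1: "z' = z1 @ [t]" by (metis rev_exhaust)
    have t: "t \<in> T" using z'(1) z1 by simp
    have "pos z1 t"
    proof (rule ccontr)
      assume "\<not> pos z1 t"
      then obtain i where i: "i < length z1" "z1 @ [t] \<approx> take i z1 @ drop (Suc i) z1"
        using exchange not_pos_iff by blast
      have "set (take i z1 @ drop (Suc i) z1) \<subseteq> T"
        using z'(1) z1 set_take_subset[of i z1] set_drop_subset[of "Suc i" z1] by auto
      from min[OF this eqw_trans[OF eqw_sym[OF i(2)] z'(2)[unfolded z1]]]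
      show False using i(1) z1 by simp
    qed
    then have n: "neg z' t" by (simp add: z1 neg_snoc)
    have "rev y \<approx> rev x @ rev z" using eqw_rev[OF assms(4)] by simp
    also have "\<dots> \<approx> rev x @ z'" using eqw_append[OF eqw_refl eqw_sym[OF z'(2)]] .
    finally have y: "rev y \<approx> rev x @ z'" .
    have "neg (rev x @ z') t"
      unfolding neg_def
      using neg_restrict[OF n z'(1) t minimal_act_nonneg[OF assms(1)]] by simp
    moreover have "pos (rev y) t" using assms(2) t by (simp add: minimal_def)
    ultimately show False using pos_cong[OF y] not_pos_neg by metis
  qed
  then show ?thesis using eqw_rev[OF z'(2)] eqw_sym by simp
qed

lemma minimal_decomposition_unique:
  assumes "minimal T x" "minimal T y" "set u \<subseteq> T" "set v \<subseteq> T" "u @ x \<approx> v @ y"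
  shows "u \<approx> v \<and> x \<approx> y"
proof -
  have vv: "rev v @ v \<approx> []" for v by (simp add: eqw_def fun_eq_iff)
  have "rev v @ u @ x \<approx> (rev v @ v) @ y" using eqw_append[OF eqw_refl assms(5), of "rev v"] by simp
  also have "\<dots> \<approx> [] @ y" by (rule eqw_append[OF vv eqw_refl])
  finally have e: "y \<approx> (rev v @ u) @ x" using eqw_sym by simp
  then have r: "rev v @ u \<approx> []" using minimal_translate_trivial assms by auto
  then have "rev v @ u \<approx> rev v @ v" using eqw_trans eqw_sym[OF vv] by blast
  then have "u \<approx> v" unfolding eqw_append_cancel_left .
  moreover have "y \<approx> [] @ x" using eqw_trans[OF e eqw_append[OF r eqw_refl]] .
  ultimately show ?thesis using eqw_sym by simp
qed

lemma braid_out: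
  assumes "minimal T x" "reduced (map fst w)" "reduced (map fst w')" "map fst w \<approx> map fst w'"
  shows "braid (map fst (out T x w)) (map fst (out T x w'))" "endpt T x w \<approx> endpt T x w'"
proof -
  have "map fst (out T x w) @ endpt T x w \<approx> x @ map fst w" using out_endpt eqw_sym by blast
  also have "\<dots> \<approx> x @ map fst w'" by (rule eqw_append[OF eqw_refl assms(4)])
  also have "\<dots> \<approx> map fst (out T x w') @ endpt T x w'" by (rule out_endpt)
  finally have "map fst (out T x w) \<approx> map fst (out T x w') \<and> endpt T x w \<approx> endpt T x w'"
    using out_letters[of T x w] out_letters[of T x w']
    by (intro minimal_decomposition_unique[of T] endpt_minimal assms(1)) simp_all
  then show "braid (map fst (out T x w)) (map fst (out T x w'))" "endpt T x w \<approx> endpt T x w'"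
    using matsumoto[OF reduced_out[OF assms(1,2)] reduced_out[OF assms(1,3)]] by blast+
qed

lemma reduced_alternating:
  assumes "s \<noteq> t" "enat k \<le> m s t"
  shows "reduced (alternating s t k)"
  using assms(2)
proof (induction k)
  case (Suc k)
  have "enat k \<le> m s t" by (rule order.trans[OF _ Suc.prems]) simp
  then have "reduced (alternating s t k)" by (rule Suc.IH)
  moreover have "pos ([] @ alternating s t k) (if even k then s else t)"
    using pos_alternating[OF assms(1) Suc.prems, of "[]"] by simp
  ultimately show ?case unfolding alternating_snoc by (simp add: reduced_snoc_iff)
qed simp

text \<open>An edge that is not a loop is not one on the way back either, as needed for the
  cancellation of a letter with its inverse.\<close>

lemma loop_snoc: "loop T (x @ [s]) s = loop T x s"
proof -
  have "(x @ [s]) @ [s] \<approx> ([t] @ x) @ [s] \<longleftrightarrow> x @ [s] \<approx> [t] @ x" for t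
    by (rule eqw_append_cancel_right)
  then show ?thesis unfolding loop_def loops_def by simp
qed

end

subsection \<open>The retraction on Artin--Tits groups\<close>

locale artin =
  fixes \<Gamma> :: "'a coxeter_graph"
  assumes graph: "is_coxeter_graph \<Gamma>"
begin

sublocale coxeter "coxeter_matrix \<Gamma>"
proof
  show "coxeter_matrix \<Gamma> s t = coxeter_matrix \<Gamma> t s" for s t
    by (simp add: coxeter_matrix_def insert_commute)
  show "2 \<le> coxeter_matrix \<Gamma> s t" if "s \<noteq> t" for s t
  proof (cases "{s, t} \<in> edges \<Gamma>")
    case True
    then have "3 \<le> label \<Gamma> {s, t}" using graph by (auto simp: is_coxeter_graph_def)
    then have "2 \<le> label \<Gamma> {s, t}" by (rule order.trans[rotated]) (simp add: numeral_eq_enat)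
    then show ?thesis using that True by (simp add: coxeter_matrix_def)
  qed (simp add: coxeter_matrix_def that)
qed

notation eqw (infix "\<approx>" 50)

abbreviation acong :: "('a word \<times> 'a word) set" where
  "acong \<equiv> pres_cong (verts \<Gamma>) (artin_relations \<Gamma>)"

definition posw :: "'a list \<Rightarrow> 'a word" where
  "posw = map (\<lambda>s. (s, True))"

lemma posw_simps [simp]:
  "posw [] = []" "posw (s # x) = (s, True) # posw x" "posw (x @ y) = posw x @ posw y"
  "map fst (posw x) = x"
  by (simp_all add: posw_def comp_def)

lemma posw_in_words [simp]: "posw x \<in> words X \<longleftrightarrow> set x \<subseteq> X"
  by (auto simp: posw_def words_def)

lemma posw_map_fst: "snd ` set w \<subseteq> {True} \<Longrightarrow> posw (map fst w) = w"
  by (induction w) auto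

lemma posw_alternating: "posw (alternating s t k) = alternating (s, True) (t, True) k"
  by (induction s t k rule: alternating.induct) simp_all

lemma words_append [simp]: "u @ v \<in> words X \<longleftrightarrow> u \<in> words X \<and> v \<in> words X"
  by (auto simp: words_def)

lemma words_simps [simp]: "[] \<in> words X" "(s, b) # w \<in> words X \<longleftrightarrow> s \<in> X \<and> w \<in> words X"
  by (auto simp: words_def)

lemma words_iff_fst: "w \<in> words X \<longleftrightarrow> fst ` set w \<subseteq> X"
  by (auto simp: words_def)

lemma braid_imp_acong: "braid x y \<Longrightarrow> set x \<subseteq> verts \<Gamma> \<Longrightarrow> (posw x, posw y) \<in> acong"
proof (induction rule: braid.induct)
  case (rel s t n)
  have "2 \<le> n" using m_ge2[of s t] rel by (simp add: numeral_eq_enat)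
  then have "{s, t} \<subseteq> verts \<Gamma>" and set: "set (alternating t s n) \<subseteq> verts \<Gamma>"
    using rel by (auto simp: set_alternating)
  then have "(posw (alternating s t n), posw (alternating t s n)) \<in> artin_relations \<Gamma>"
    using rel unfolding artin_relations_def posw_alternating by blast
  then show ?case using rel set by (intro pres_cong.rel) simp_all
next
  case (trans x y z)
  then show ?case using braid_set pres_cong.trans by blast
next
  case (app x x' y y')
  then show ?case using pres_cong.app by fastforce
qed (simp add: pres_cong.refl)

text \<open>Forgetting signs is the projection from the Artin group to the Coxeter group.\<close>

lemma acong_imp_eqw: "(u, v) \<in> acong \<Longrightarrow> map fst u \<approx> map fst v"
proof (induction rule: pres_cong.induct)
  case (cancel s b)
  then show ?case using eqw_cancel[of "[]" s "[]"] by simp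
next
  case (rel l r)
  then obtain s t n where "s \<noteq> t" "coxeter_matrix \<Gamma> s t = enat n"
    "l = posw (alternating s t n)" "r = posw (alternating t s n)"
    unfolding artin_relations_def posw_alternating by blast
  then show ?case by (simp add: eqw_braid)
qed (auto intro: eqw_sym eqw_trans eqw_append)

text \<open>This makes \<open>out\<close> well defined on the group. The starting state is arbitrary
  because the second factor of a product is read from the endpoint of the first.\<close>

lemma out_invariant:
  assumes "T \<subseteq> verts \<Gamma>" "(u, v) \<in> acong"
  shows "minimal T x \<Longrightarrow> (out T x u, out T x v) \<in> acong \<and> endpt T x u \<approx> endpt T x v"
  using assms(2)
proof (induction arbitrary: x rule: pres_cong.induct)
  case (cancel s b)
  show ?case
  proof (cases "loop T x s")
    case None
    then show ?thesis using eqw_cancel[of x s "[]"] by (simp add: loop_snoc pres_cong.refl)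
  next
    case (Some t)
    then have "t \<in> verts \<Gamma>" using assms(1) by (auto simp: loop_eq_Some_iff loops_def)
    then show ?thesis using Some by (simp add: pres_cong.cancel)
  qed
next
  case (rel l r)
  then obtain s t n where st: "s \<noteq> t" "coxeter_matrix \<Gamma> s t = enat n"
    "l = posw (alternating s t n)" "r = posw (alternating t s n)"
    unfolding artin_relations_def posw_alternating by blast
  have red: "reduced (map fst l)" "reduced (map fst r)" "map fst l \<approx> map fst r"
    using st reduced_alternating[of s t n] reduced_alternating[of t s n] m_sym[of s t]
    by (simp_all add: eqw_braid)
  \<comment> \<open>Output signs come from input signs, so both outputs are positive words and the
    braid equivalence of their letters lifts to the group.\<close>
  have True: "snd ` set l \<subseteq> {True}" "snd ` set r \<subseteq> {True}" by (auto simp: st posw_def)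
  have "(posw (map fst (out T x l)), posw (map fst (out T x r))) \<in> acong"
    using braid_out(1)[OF rel.prems red] out_letters[of T x l] assms(1)
    by (intro braid_imp_acong) auto
  then have "(out T x l, out T x r) \<in> acong"
    using posw_map_fst[of "out T x l"] posw_map_fst[of "out T x r"] out_signs[of T x] True
    by (metis order.trans)
  then show ?case using braid_out(2)[OF rel.prems red] by simp
next
  case (refl w)
  have "out T x w \<in> words (verts \<Gamma>)"
    using out_letters[of T x w] assms(1) by (auto simp: words_iff_fst)
  then show ?case by (simp add: pres_cong.refl)
next
  case (sym u v)
  then show ?case using pres_cong.sym eqw_sym by blast
next
  case (trans u v w)
  then show ?case using pres_cong.trans eqw_trans by blast
next
  case (app u u' v v')
  have 1: "(out T x u, out T x u') \<in> acong" "endpt T x u \<approx> endpt T x u'"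
    using app by blast+
  have 2: "(out T (endpt T x u) v, out T (endpt T x u) v') \<in> acong"
      "endpt T (endpt T x u) v \<approx> endpt T (endpt T x u) v'"
    using app endpt_minimal by blast+
  show ?case
    using pres_cong.app[OF 1(1) 2(1)] out_cong[OF 1(2), of T v']
      eqw_trans[OF 2(2) endpt_cong[OF 1(2), of T v']]
    by (simp add: out_append endpt_append)
qed

text \<open>At the trivial coset every letter of \<open>T\<close> is a loop labelled by
  itself.\<close>

lemma out_parabolic: "w \<in> words T \<Longrightarrow> out T [] w = w"
proof (induction w)
  case (Cons l w)
  obtain s b where l: "l = (s, b)" by (cases l)
  have "loop T [] s = Some s" using Cons.prems by (simp add: l loop_eq_Some_iff loops_def)
  then show ?case using Cons by (simp add: l)
qed simp

section \<open>Classes of words and standard parabolic subgroups\<close>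

definition cls :: "'a word \<Rightarrow> 'a word set" where
  "cls w = acong `` {w}"

lemma cls_eq_iff: "u \<in> words (verts \<Gamma>) \<Longrightarrow> v \<in> words (verts \<Gamma>) \<Longrightarrow> cls u = cls v \<longleftrightarrow> (u, v) \<in> acong"
  unfolding cls_def using eq_equiv_class_iff[OF equiv_pres_cong] .

lemma group_artin: "group (artin_group \<Gamma>)"
  unfolding artin_group_def by (rule group_presented_group)

lemma carrier_artin: "carrier (artin_group \<Gamma>) = cls ` words (verts \<Gamma>)"
  by (auto simp: artin_group_def presented_group_def quotient_def cls_def)

lemma mult_cls:
  "u \<in> words (verts \<Gamma>) \<Longrightarrow> v \<in> words (verts \<Gamma>) \<Longrightarrow> cls u \<otimes>\<^bsub>artin_group \<Gamma>\<^esub> cls v = cls (u @ v)"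
  unfolding cls_def artin_group_def by (rule presented_group_mult)

lemma one_artin: "\<one>\<^bsub>artin_group \<Gamma>\<^esub> = cls []"
  by (simp add: artin_group_def presented_group_def cls_def)

lemma artin_gen_eq: "artin_gen \<Gamma> s = cls [(s, True)]"
  by (simp add: artin_gen_def cls_def)

lemma inv_artin_gen:
  assumes "s \<in> verts \<Gamma>"
  shows "inv\<^bsub>artin_group \<Gamma>\<^esub> artin_gen \<Gamma> s = cls [(s, False)]"
proof -
  interpret group "artin_group \<Gamma>" by (rule group_artin)
  have "([(s, False), (s, True)], []) \<in> acong"
    using pres_cong.cancel[OF assms, of False] by simp
  then have "cls [(s, False)] \<otimes>\<^bsub>artin_group \<Gamma>\<^esub> artin_gen \<Gamma> s = \<one>\<^bsub>artin_group \<Gamma>\<^esub>"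
    using assms by (simp add: artin_gen_eq mult_cls one_artin cls_eq_iff)
  then show ?thesis using assms by (intro inv_equality) (auto simp: carrier_artin artin_gen_eq)
qed

lemma word_value_eq: "w \<in> words (verts \<Gamma>) \<Longrightarrow> word_value (artin_group \<Gamma>) (artin_gen \<Gamma>) w = cls w"
proof (induction w)
  case (Cons l w)
  obtain s b where l: "l = (s, b)" by (cases l)
  have "(if b then artin_gen \<Gamma> s else inv\<^bsub>artin_group \<Gamma>\<^esub> artin_gen \<Gamma> s) = cls [(s, b)]"
    using Cons.prems by (cases b) (simp_all add: l inv_artin_gen, simp add: artin_gen_eq)
  then show ?case using Cons by (simp add: l mult_cls)
qed (simp add: one_artin)

lemma represents_iff: "w \<in> words (verts \<Gamma>) \<Longrightarrow> represents \<Gamma> w \<alpha> \<longleftrightarrow> \<alpha> = cls w"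
  by (auto simp: represents_def word_value_eq)

lemma standard_parabolic_eq:
  assumes "T \<subseteq> verts \<Gamma>"
  shows "standard_parabolic \<Gamma> T = cls ` words T"
proof
  have w: "w \<in> words (verts \<Gamma>)" if "w \<in> words T" for w
    using that assms by (auto simp: words_iff_fst)
  show "standard_parabolic \<Gamma> T \<subseteq> cls ` words T"
  proof
    fix \<alpha> assume "\<alpha> \<in> standard_parabolic \<Gamma> T"
    then show "\<alpha> \<in> cls ` words T"
      unfolding standard_parabolic_def
    proof (induction rule: generate.induct)
      case (incl h)
      then show ?case by (force simp: artin_gen_eq)
    next
      case (inv h)
      then obtain t where "t \<in> T" "h = artin_gen \<Gamma> t" by blast
      then show ?case using assms by (auto simp: inv_artin_gen intro!: image_eqI[of _ cls "[(t, False)]"])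
    next
      case (eng h1 h2)
      then obtain u v where "u \<in> words T" "v \<in> words T" "h1 = cls u" "h2 = cls v" by blast
      then show ?case by (auto simp: mult_cls w intro!: image_eqI[of _ cls "u @ v"])
    qed (auto simp: one_artin)
  qed
  show "cls ` words T \<subseteq> standard_parabolic \<Gamma> T"
  proof clarify
    fix u assume "u \<in> words T"
    then show "cls u \<in> standard_parabolic \<Gamma> T"
    proof (induction u)
      case Nil
      show ?case unfolding standard_parabolic_def one_artin[symmetric] by (rule generate.one)
    next
      case (Cons l u)
      obtain t b where l: "l = (t, b)" by (cases l)
      have t: "t \<in> T" "t \<in> verts \<Gamma>" and u: "u \<in> words T" using Cons.prems assms by (auto simp: l)
      have "cls [(t, b)] \<in> standard_parabolic \<Gamma> T"
        using t generate.incl[of "artin_gen \<Gamma> t" "artin_gen \<Gamma> ` T" "artin_group \<Gamma>"]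
          generate.inv[of "artin_gen \<Gamma> t" "artin_gen \<Gamma> ` T" "artin_group \<Gamma>"]
        unfolding standard_parabolic_def
        by (cases b) (simp_all add: inv_artin_gen, simp add: artin_gen_eq)
      then have "cls [(t, b)] \<otimes>\<^bsub>artin_group \<Gamma>\<^esub> cls u \<in> standard_parabolic \<Gamma> T"
        using Cons.IH[OF u] unfolding standard_parabolic_def by (rule generate.eng)
      then show ?case using t w[OF u] by (simp add: l mult_cls)
    qed
  qed
qed

lemma mem_parabolic_iff:
  assumes "T \<subseteq> verts \<Gamma>" "w \<in> words (verts \<Gamma>)"
  shows "cls w \<in> standard_parabolic \<Gamma> T \<longleftrightarrow> (out T [] w, w) \<in> acong"
proof
  have o: "out T [] w \<in> words T" using out_letters[of T "[]" w] by (simp add: words_iff_fst)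
  then have o': "out T [] w \<in> words (verts \<Gamma>)" using assms(1) by (auto simp: words_iff_fst)
  {
    assume "cls w \<in> standard_parabolic \<Gamma> T"
    then obtain u where u: "u \<in> words T" "cls w = cls u"
      using standard_parabolic_eq[OF assms(1)] by blast
    then have uw: "(w, u) \<in> acong"
      using assms cls_eq_iff[of w u] by (auto simp: words_iff_fst)
    then have "(out T [] w, u) \<in> acong"
      using out_invariant[OF assms(1) uw, of "[]"] out_parabolic[OF u(1)] by simp
    then show "(out T [] w, w) \<in> acong" using uw pres_cong.sym pres_cong.trans by blast
  }
  {
    assume "(out T [] w, w) \<in> acong"
    then have "cls w = cls (out T [] w)" using cls_eq_iff[OF o' assms(2)] by simp
    then show "cls w \<in> standard_parabolic \<Gamma> T"
      using o standard_parabolic_eq[OF assms(1)] by blast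
  }
qed

subsection \<open>Following the retraction through reduced words\<close>

definition invw :: "'a word \<Rightarrow> 'a word" where
  "invw w = rev (map (\<lambda>(s, b). (s, \<not> b)) w)"

lemma invw_words [simp]: "invw w \<in> words X \<longleftrightarrow> w \<in> words X"
  by (force simp: invw_def words_def)

lemma invw_invw [simp]: "invw (invw w) = w"
  by (induction w) (auto simp: invw_def)

lemma acong_iff_trivial:
  assumes "u \<in> words (verts \<Gamma>)" "v \<in> words (verts \<Gamma>)"
  shows "(u @ invw v, []) \<in> acong \<longleftrightarrow> (u, v) \<in> acong"
proof
  have l: "(invw w @ w, []) \<in> acong" if "w \<in> words (verts \<Gamma>)" for w
    unfolding invw_def by (rule pres_cong_inverse_word[OF that])
  have r: "(v @ invw v, []) \<in> acong" using l[of "invw v"] assms(2) by simp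
  {
    assume "(u, v) \<in> acong"
    then have "(u @ invw v, v @ invw v) \<in> acong"
      using assms(2) by (intro pres_cong.app pres_cong.refl) simp_all
    then show "(u @ invw v, []) \<in> acong" using r pres_cong.trans by blast
  }
  {
    assume a: "(u @ invw v, []) \<in> acong"
    have "(u @ invw v @ v, u @ []) \<in> acong"
      using assms l by (intro pres_cong.app pres_cong.refl)
    moreover have "((u @ invw v) @ v, [] @ v) \<in> acong"
      using assms a by (intro pres_cong.app pres_cong.refl)
    ultimately show "(u, v) \<in> acong" using pres_cong.sym pres_cong.trans by fastforce
  }
qed

lemma reduced_eqw_imp_acong:
  "reduced x \<Longrightarrow> x \<approx> y \<Longrightarrow> length y = length x \<Longrightarrow> set x \<subseteq> verts \<Gamma> \<Longrightarrow> (posw x, posw y) \<in> acong"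
  by (rule braid_imp_acong[OF matsumoto]) (simp_all add: reduced_eqw[OF _ eqw_sym])

text \<open>At a loop \<open>x\<close> keeps \<open>\<alpha>\<^sub>s\<close> positive, so
  \<open>x s\<close> is reduced, and so is \<open>t x\<close>, having the same length. By
  Matsumoto's theorem equality in the Coxeter group is then equality in the Artin group.\<close>

lemma loops_iff_acong:
  assumes "reduced x" "minimal T x" "set x \<subseteq> verts \<Gamma>" "s \<in> verts \<Gamma>" "t \<in> T"
  shows "loops T x s t \<longleftrightarrow> (posw (x @ [s]), posw ([t] @ x)) \<in> acong"
proof
  assume l: "loops T x s t"
  then obtain c where c: "0 < c" "\<And>f. act (rev x) f t = c * f s"
    using loops_simple_root assms(2) by blast
  have "pos x s"
    unfolding pos_def
  proof (intro allI impI)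
    fix g :: "'a \<Rightarrow> real" assume "\<forall>r. 0 \<le> g r"
    then have "0 \<le> c * act x g s" using c(2)[of "act x g"] by (metis act_rev(1))
    then show "0 \<le> act x g s" using c(1) by (simp add: zero_le_mult_iff)
  qed
  then have "reduced (x @ [s])" using reduced_snoc_iff[OF assms(1)] by simp
  then show "(posw (x @ [s]), posw ([t] @ x)) \<in> acong"
    using l assms(3,4) by (intro reduced_eqw_imp_acong) (auto simp: loops_def)
next
  assume "(posw (x @ [s]), posw ([t] @ x)) \<in> acong"
  from acong_imp_eqw[OF this] show "loops T x s t" using assms(5) by (simp add: loops_def)
qed

text \<open>The test compares \<open>y s\<close> with \<open>x\<close>, not \<open>x s\<close> with
  \<open>y\<close>: the former two are reduced words of the same element, so comparing them in the
  Artin group loses nothing.\<close>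

lemma deletion_step:
  assumes "reduced x" "minimal T x" "loop T x s = None" "i < length x"
    "(posw (take i x @ drop (Suc i) x @ [s]), posw x) \<in> acong"
  defines "y \<equiv> take i x @ drop (Suc i) x"
  shows "reduced y" "minimal T y" "x @ [s] \<approx> y" "set y \<subseteq> set x"
proof -
  have yx: "y @ [s] \<approx> x" using acong_imp_eqw[OF assms(5)] by (simp add: y_def)
  have "reduced (y @ [s])" using assms(4) by (intro reduced_eqw[OF assms(1) yx]) (simp add: y_def)
  then show "reduced y" by (rule reduced_prefix)
  show xy: "x @ [s] \<approx> y" using yx eqw_snoc_iff eqw_sym by blast
  show "minimal T y" using minimal_snoc[OF assms(2,3)] minimal_cong[OF xy] by simp
  show "set y \<subseteq> set x"
    using set_take_subset[of i x] set_drop_subset[of "Suc i" x] by (auto simp: y_def)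
qed

text \<open>If \<open>s\<close> were a descent, the exchange condition would provide a deletion, and
  Matsumoto's theorem would make its test succeed.\<close>

lemma extension_step:
  assumes "reduced x" "set x \<subseteq> verts \<Gamma>"
    "\<And>i. i < length x \<Longrightarrow> (posw (take i x @ drop (Suc i) x @ [s]), posw x) \<notin> acong"
  shows "reduced (x @ [s])"
proof -
  have "pos x s"
  proof (rule ccontr)
    assume "\<not> pos x s"
    then obtain i where i: "i < length x" "x @ [s] \<approx> take i x @ drop (Suc i) x"
      using exchange not_pos_iff by blast
    then have "x \<approx> (take i x @ drop (Suc i) x) @ [s]" using eqw_snoc_iff by blast
    then have "(posw x, posw (take i x @ drop (Suc i) x @ [s])) \<in> acong"
      using assms(1,2) i(1) by (intro reduced_eqw_imp_acong) auto
    then show False using assms(3)[OF i(1)] pres_cong.sym by blast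
  qed
  then show ?thesis using reduced_snoc_iff[OF assms(1)] by simp
qed

end

subsection \<open>Running the retraction with an oracle for the word problem\<close>

text \<open>
  \<open>search\<close> moves a cursor, splitting a list into its reversed past and its future, up to the first
  position satisfying \<open>P\<close>; positions where it stops are fixed points, so any large enough number of
  iterations will do.
\<close>

definition search :: "(nat list \<Rightarrow> nat list \<Rightarrow> bool) \<Rightarrow> nat list \<times> nat list \<Rightarrow> nat list \<times> nat list" where
  "search P z = (if snd z = [] \<or> P (fst z) (snd z) then z else (hd0 (snd z) # fst z, tl (snd z)))"

lemma search_funpow:
  "\<exists>i\<le>length x. (search P ^^ n) ([], x) = (rev (take i x), drop i x) \<and>
     (\<forall>j<i. \<not> P (rev (take j x)) (drop j x)) \<and> (i < length x \<longrightarrow> P (rev (take i x)) (drop i x) \<or> n \<le> i)"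
proof (induction n)
  case 0
  show ?case by (intro exI[of _ 0]) simp
next
  case (Suc n)
  then obtain i where i: "i \<le> length x" "(search P ^^ n) ([], x) = (rev (take i x), drop i x)"
    "\<forall>j<i. \<not> P (rev (take j x)) (drop j x)"
    "i < length x \<longrightarrow> P (rev (take i x)) (drop i x) \<or> n \<le> i" by blast
  show ?case
  proof (cases "i = length x \<or> P (rev (take i x)) (drop i x)")
    case True
    have "(search P ^^ Suc n) ([], x) = search P (rev (take i x), drop i x)" using i(2) by simp
    also have "\<dots> = (rev (take i x), drop i x)" using True by (auto simp: search_def)
    finally show ?thesis using True i(1,3) by blast
  next
    case False
    then have l: "i < length x" using i(1) by simp
    have "drop i x = x ! i # drop (Suc i) x" using l by (rule Cons_nth_drop_Suc[symmetric])
    moreover have "take (Suc i) x = take i x @ [x ! i]" using l by (rule take_Suc_conv_app_nth)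
    moreover have "(search P ^^ Suc n) ([], x) = search P (rev (take i x), drop i x)"
      using i(2) by simp
    ultimately have "(search P ^^ Suc n) ([], x) = (rev (take (Suc i) x), drop (Suc i) x)"
      using False l by (simp add: search_def)
    then show ?thesis
      using False l i(3,4) by (intro exI[of _ "Suc i"]) (auto simp: less_Suc_eq)
  qed
qed

lemma search_result:
  assumes "length x \<le> n"
  obtains (found) i where "i < length x" "(search P ^^ n) ([], x) = (rev (take i x), drop i x)"
      "P (rev (take i x)) (drop i x)"
  | (absent) "(search P ^^ n) ([], x) = (rev x, [])"
      "\<And>i. i < length x \<Longrightarrow> \<not> P (rev (take i x)) (drop i x)"
proof -
  obtain i where i: "i \<le> length x" "(search P ^^ n) ([], x) = (rev (take i x), drop i x)"
    "\<forall>j<i. \<not> P (rev (take j x)) (drop j x)"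
    "i < length x \<longrightarrow> P (rev (take i x)) (drop i x) \<or> n \<le> i" using search_funpow by metis
  show ?thesis
  proof (cases "i = length x")
    case True
    then show ?thesis using absent i by simp
  next
    case False
    then show ?thesis using found[of i] i assms by simp
  qed
qed

text \<open>\<open>Q\<close> is total on lists of numbers but is specified only on codes of words
  over the vertices.\<close>

locale artin_oracle = artin +
  fixes num :: "'a \<Rightarrow> nat" and Q :: "nat list \<Rightarrow> bool"
  assumes inj_num: "inj_on num (verts \<Gamma>)"
    and computable_Q: "computable list_encode of_bool Q"
    and Q_iff: "w \<in> words (verts \<Gamma>) \<Longrightarrow>
      Q (map (\<lambda>(s, b). 2 * num s + of_bool b) w) \<longleftrightarrow> (w, []) \<in> acong"
begin

definition ltr :: "'a \<times> bool \<Rightarrow> nat" where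
  "ltr = (\<lambda>(s, b). 2 * num s + of_bool b)"

definition ltrs :: "nat set" where
  "ltrs = ltr ` (verts \<Gamma> \<times> UNIV)"

text \<open>The table \<open>ltrs\<close> is finite, so computability of \<open>flip\<close> needs no division algorithm.\<close>

definition flip :: "nat \<Rightarrow> nat" where
  "flip c = (if c \<in> ltrs then if even c then c + 1 else c - 1 else 0)"

abbreviation wc :: "'a word \<Rightarrow> nat list" where
  "wc \<equiv> map ltr"

definition invc :: "nat list \<Rightarrow> nat list" where
  "invc l = rev (map flip l)"

lemma finite_ltrs: "finite ltrs"
  using graph by (simp add: ltrs_def is_coxeter_graph_def)

lemma inj_ltr: "inj_on ltr (verts \<Gamma> \<times> UNIV)"
proof (rule inj_onI, clarify)
  fix s t b c assume a: "s \<in> verts \<Gamma>" "t \<in> verts \<Gamma>" "ltr (s, b) = ltr (t, c)"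
  then have "num s = num t \<and> b = c" by (cases b; cases c) (simp_all add: ltr_def, presburger+)
  then show "s = t \<and> b = c" using a inj_num by (simp add: inj_on_def)
qed

lemma ltr_in_ltrs: "s \<in> verts \<Gamma> \<Longrightarrow> ltr (s, b) \<in> ltrs"
  by (simp add: ltrs_def)

lemma flip_ltr: "s \<in> verts \<Gamma> \<Longrightarrow> flip (ltr (s, b)) = ltr (s, \<not> b)"
  unfolding flip_def by (simp add: ltr_in_ltrs) (simp add: ltr_def)

lemma invc_wc: "w \<in> words (verts \<Gamma>) \<Longrightarrow> invc (wc w) = wc (invw w)"
  by (induction w) (auto simp: invw_def invc_def flip_ltr)

lemma computable_flip: "computable id id flip"
proof -
  have "computable id id (\<lambda>c. if c \<in> ltrs then (\<lambda>a x. if even a then a + 1 else a - 1) c c else 0)"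
    by (intro computable_finite_cases[OF finite_ltrs] computable_ident computable_const)
  then show ?thesis by (simp add: flip_def[abs_def])
qed

lemma computable_invc: "computable_list ea l \<Longrightarrow> computable_list ea (\<lambda>x. invc (l x))"
  unfolding invc_def by (rule computable_rev_map[OF computable_flip])

lemma Q_wc: "w \<in> words (verts \<Gamma>) \<Longrightarrow> Q (wc w) \<longleftrightarrow> (w, []) \<in> acong"
  using Q_iff by (simp add: ltr_def)

lemma Q_wc_inverse:
  "u \<in> words (verts \<Gamma>) \<Longrightarrow> v \<in> words (verts \<Gamma>) \<Longrightarrow> Q (wc u @ invc (wc v)) \<longleftrightarrow> (u, v) \<in> acong"
  using Q_wc[of "u @ invw v"] by (simp add: invc_wc acong_iff_trivial)

definition loop_test :: "'a \<Rightarrow> 'a \<Rightarrow> nat list \<Rightarrow> bool" where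
  "loop_test s t x \<longleftrightarrow> Q ((x @ [ltr (s, True)]) @ invc (ltr (t, True) # x))"

text \<open>\<open>p\<close> is the reversed past and \<open>r\<close> the future of the cursor; the
  letter tried for deletion is the head of \<open>r\<close>.\<close>

definition deletion_test :: "'a \<Rightarrow> nat list \<Rightarrow> nat list \<Rightarrow> bool" where
  "deletion_test s p r \<longleftrightarrow> Q ((rev p @ tl r @ [ltr (s, True)]) @ invc (rev p @ r))"

definition move :: "'a \<Rightarrow> nat list \<Rightarrow> nat list" where
  "move s x = (let z = (search (deletion_test s) ^^ list_encode x) ([], x) in
     if snd z = [] then x @ [ltr (s, True)] else rev (fst z) @ tl (snd z))"

text \<open>The state pairs a reduced word of the current coset representative with the reversed
  output so far.\<close>

definition mstep :: "'a list \<Rightarrow> 'a \<times> bool \<Rightarrow> nat list \<times> nat list \<Rightarrow> nat list \<times> nat list" where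
  "mstep ts l z = (case find (\<lambda>t. loop_test (fst l) t (fst z)) ts of
     None \<Rightarrow> (move (fst l) (fst z), snd z) | Some t \<Rightarrow> (fst z, ltr (t, snd l) # snd z))"

text \<open>Decoding a letter is a lookup in the finite table \<open>ltrs\<close>, so no
  computability of \<open>inv_into\<close> is involved; other numbers leave the state alone.\<close>

definition read :: "'a list \<Rightarrow> nat \<Rightarrow> nat list \<times> nat list \<Rightarrow> nat list \<times> nat list" where
  "read ts c z = (if c \<in> ltrs then mstep ts (inv_into (verts \<Gamma> \<times> UNIV) ltr c) z else z)"

definition machine :: "'a list \<Rightarrow> nat list \<Rightarrow> nat list" where
  "machine ts l = rev (snd (fold (read ts) l ([], [])))"

lemma computable_Q': "computable_list ea l \<Longrightarrow> computable ea of_bool (\<lambda>x. Q (l x))"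
  by (rule computable_comp[OF _ computable_Q])

lemma computable_singleton: "computable_list ea (\<lambda>x. [c])"
  by (rule computable_const)

lemma computable_loop_test:
  "computable_list ea x \<Longrightarrow> computable ea of_bool (\<lambda>z. loop_test s t (x z))"
  unfolding loop_test_def
  by (intro computable_Q' computable_append computable_singleton computable_invc
      computable_Cons computable_const)

abbreviation "pc \<equiv> pair_code list_encode list_encode"

lemma computable_move:
  assumes "computable_list ea x" shows "computable_list ea (\<lambda>z. move s (x z))"
proof -
  note fs = computable_fst[OF computable_ident] computable_snd[OF computable_ident]
  have t: "computable pc of_bool (\<lambda>z. deletion_test s (fst z) (snd z))"
    unfolding deletion_test_def
    by (intro computable_Q' computable_append computable_singleton computable_invc computable_rev computable_tl fs)
  have "computable pc pc (search (deletion_test s))"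
    unfolding search_def[abs_def]
    by (intro computable_if computable_disj computable_null t fs computable_ident
        computable_pair computable_Cons computable_hd0 computable_tl)
  from computable_funpow[OF this computable_list_encode[OF assms] computable_pair[OF computable_const assms]]
  have z: "computable ea pc (\<lambda>z. (search (deletion_test s) ^^ list_encode (x z)) ([], x z))" .
  note zs = computable_fst[OF z] computable_snd[OF z]
  show ?thesis
    unfolding move_def Let_def
    by (intro computable_if computable_null computable_append computable_singleton computable_rev
        computable_tl assms zs)
qed

lemma computable_read: "computable (pair_code id pc) pc (\<lambda>(c, z). read ts c z)"
proof -
  let ?e = "pair_code id pc"
  have c: "computable ?e id (\<lambda>y. fst y)" and z: "computable ?e pc (\<lambda>y. snd y)"
    by (rule computable_fst[OF computable_ident] computable_snd[OF computable_ident])+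
  have m: "computable ?e pc (\<lambda>y. mstep ts l (snd y))" for l
    unfolding mstep_def
    by (intro computable_find computable_loop_test computable_pair computable_move
        computable_Cons computable_const computable_fst[OF z] computable_snd[OF z])
  have "computable ?e pc (\<lambda>y. if fst y \<in> ltrs
      then (\<lambda>c y. mstep ts (inv_into (verts \<Gamma> \<times> UNIV) ltr c) (snd y)) (fst y) y else snd y)"
    by (intro computable_finite_cases[OF finite_ltrs] c z m)
  then show ?thesis by (simp add: read_def case_prod_unfold)
qed

lemma computable_machine:
  assumes "computable_list ea l" shows "computable_list ea (\<lambda>z. machine ts (l z))"
proof -
  have "computable ea pc (\<lambda>z. fold (read ts) (l z) ([], []))"
    by (rule computable_fold[OF computable_read assms computable_const])
  then show ?thesis unfolding machine_def by (intro computable_rev computable_snd)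
qed

lemma move_correct:
  assumes "reduced x" "minimal T x" "set x \<subseteq> verts \<Gamma>" "s \<in> verts \<Gamma>" "loop T x s = None"
  obtains y where "move s (wc (posw x)) = wc (posw y)" "reduced y" "minimal T y" "x @ [s] \<approx> y"
    "set y \<subseteq> verts \<Gamma>"
proof -
  let ?x = "wc (posw x)"
  have wc: "rev (rev (take i ?x)) @ tl (drop i ?x) = wc (posw (take i x @ drop (Suc i) x))" for i
  proof -
    have "tl (drop i ?x) = drop (Suc i) ?x" by (simp add: drop_Suc tl_drop)
    then show ?thesis by (simp add: posw_def take_map drop_map)
  qed
  have test: "deletion_test s (rev (take i ?x)) (drop i ?x) \<longleftrightarrow>
      (posw (take i x @ drop (Suc i) x @ [s]), posw x) \<in> acong" if "i < length x" for i
  proof -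
    have "set (take i x @ drop (Suc i) x @ [s]) \<subseteq> verts \<Gamma>"
      using assms(3,4) set_take_subset[of i x] set_drop_subset[of "Suc i" x] by auto
    then have "Q (wc (posw (take i x @ drop (Suc i) x @ [s])) @ invc (wc (posw x))) \<longleftrightarrow>
        (posw (take i x @ drop (Suc i) x @ [s]), posw x) \<in> acong"
      by (intro Q_wc_inverse) (use assms(3) in \<open>simp_all del: posw_simps\<close>)
    moreover have "rev (rev (take i ?x)) @ tl (drop i ?x) @ [ltr (s, True)] =
        wc (posw (take i x @ drop (Suc i) x @ [s]))"
      using wc[of i] by simp
    moreover have "rev (rev (take i ?x)) @ drop i ?x = ?x" by simp
    ultimately show ?thesis
      unfolding deletion_test_def by (simp only:)
  qed
  have "length ?x \<le> list_encode ?x" by (rule length_le_list_encode)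
  then show ?thesis
  proof (cases rule: search_result[where P = "deletion_test s"])
    case (found i)
    then have i: "i < length x" by (simp add: posw_def)
    note d = deletion_step[OF assms(1,2,5) i test[OF i, THEN iffD1, OF found(3)]]
    have "move s ?x = wc (posw (take i x @ drop (Suc i) x))"
      unfolding move_def found(2) Let_def using found(1) wc[of i] by simp
    then show ?thesis using that d assms(3) by blast
  next
    case absent
    have "reduced (x @ [s])"
      by (rule extension_step[OF assms(1,3)]) (use absent(2) test in \<open>simp add: posw_def\<close>)
    moreover have "move s ?x = wc (posw (x @ [s]))"
      unfolding move_def absent(1) Let_def by simp
    ultimately show ?thesis
      using that[of "x @ [s]"] minimal_snoc[OF assms(2,5)] assms(3,4) by simp
  qed
qed

text \<open>Loop labels are unique, so the order of \<open>ts\<close> does not affect which one is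
  found.\<close>

lemma find_loop:
  assumes "reduced x" "minimal T x" "set x \<subseteq> verts \<Gamma>" "s \<in> verts \<Gamma>" "set ts = T" "T \<subseteq> verts \<Gamma>"
  shows "find (\<lambda>t. loop_test s t (wc (posw x))) ts = loop T x s"
proof -
  have test: "loop_test s t (wc (posw x)) \<longleftrightarrow> loops T x s t" if "t \<in> T" for t
  proof -
    have "set (x @ [s]) \<subseteq> verts \<Gamma>" "set ([t] @ x) \<subseteq> verts \<Gamma>" using assms that by auto
    then have "Q (wc (posw (x @ [s])) @ invc (wc (posw ([t] @ x)))) \<longleftrightarrow> loops T x s t"
      unfolding loops_iff_acong[OF assms(1-4) that] by (intro Q_wc_inverse) (simp_all del: posw_simps)
    then show ?thesis by (simp add: loop_test_def)
  qed
  show ?thesis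
  proof (cases "find (\<lambda>t. loop_test s t (wc (posw x))) ts")
    case None
    then have "\<not> loops T x s t" for t
      using test assms(5) by (auto simp: find_None_iff loops_def)
    then show ?thesis using None loop_eq_None_iff by metis
  next
    case (Some t)
    then have "t \<in> T \<and> loop_test s t (wc (posw x))"
      using assms(5) by (auto simp: find_Some_iff)
    then have "loop T x s = Some t" using test loop_eq_Some_iff by blast
    then show ?thesis using Some by simp
  qed
qed

text \<open>The machine replaces \<open>x s\<close> by a reduced word of the same element, and
  \<open>out_cong\<close> shows that the output is unchanged.\<close>

lemma fold_read:
  assumes "set ts = T" "T \<subseteq> verts \<Gamma>"
  shows "w \<in> words (verts \<Gamma>) \<Longrightarrow> reduced x \<Longrightarrow> minimal T x \<Longrightarrow> set x \<subseteq> verts \<Gamma> \<Longrightarrow>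
    snd (fold (read ts) (wc w) (wc (posw x), u)) = rev (wc (out T x w)) @ u"
proof (induction w arbitrary: x u)
  case (Cons l w)
  obtain s b where l: "l = (s, b)" by (cases l)
  have s: "s \<in> verts \<Gamma>" and w: "w \<in> words (verts \<Gamma>)" using Cons.prems(1) by (auto simp: l)
  have "inv_into (verts \<Gamma> \<times> UNIV) ltr (ltr l) = l"
    using s by (intro inv_into_f_f inj_ltr) (simp add: l)
  moreover have "ltr l \<in> ltrs" using s by (simp add: ltrs_def l)
  ultimately have r: "read ts (ltr l) z = mstep ts l z" for z by (simp add: read_def)
  note f = find_loop[OF Cons.prems(2-4) s assms]
  show ?case
  proof (cases "loop T x s")
    case None
    obtain y where y: "move s (wc (posw x)) = wc (posw y)" "reduced y" "minimal T y" "x @ [s] \<approx> y"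
      "set y \<subseteq> verts \<Gamma>"
      using move_correct[OF Cons.prems(2-4) s None] by blast
    have "mstep ts l (wc (posw x), u) = (wc (posw y), u)"
      using f None y(1) by (simp add: mstep_def l)
    then have "snd (fold (read ts) (wc (l # w)) (wc (posw x), u)) = rev (wc (out T y w)) @ u"
      using Cons.IH[OF w y(2,3,5)] by (simp add: r)
    then show ?thesis using None out_cong[OF y(4), of T w] by (simp add: l)
  next
    case (Some t)
    have "mstep ts l (wc (posw x), u) = (wc (posw x), ltr (t, b) # u)"
      using f Some by (simp add: mstep_def l)
    then have "snd (fold (read ts) (wc (l # w)) (wc (posw x), u)) = rev (wc (out T x w)) @ ltr (t, b) # u"
      using Cons.IH[OF w Cons.prems(2-4)] by (simp add: r)
    then show ?thesis using Some by (simp add: l)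
  qed
qed simp

lemma machine_correct:
  "set ts = T \<Longrightarrow> T \<subseteq> verts \<Gamma> \<Longrightarrow> w \<in> words (verts \<Gamma>) \<Longrightarrow> machine ts (wc w) = wc (out T [] w)"
  using fold_read[of ts T w "[]" "[]"] by (simp add: machine_def)

section \<open>One algorithm for all subsets of the vertex set\<close>

definition kappa :: "'a word \<times> 'a set \<Rightarrow> 'a word option" where
  "kappa = (\<lambda>(w, T). if (out T [] w, w) \<in> acong then Some (out T [] w) else None)"

lemma computable_kappa:
  "computable_on (word_subset_code num) (words (verts \<Gamma>) \<times> Pow (verts \<Gamma>)) (word_option_code num) kappa"
proof -
  let ?code = "\<lambda>T. set_encode (num ` T)"
  let ?e = "pair_code list_encode id"
  define A where "A = ?code ` Pow (verts \<Gamma>)"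
  define set_of where "set_of = inv_into (Pow (verts \<Gamma>)) ?code"
  \<comment> \<open>Only finitely many \<open>T\<close> occur, so arbitrary choices are harmless:
    each code of a subset selects its own fixed machine.\<close>
  define list_of where "list_of T = (SOME ts. set ts = T)" for T :: "'a set"
  \<comment> \<open>The values follow \<open>word_option_code\<close>: 0 for \<open>None\<close>,
    the successor of a code for \<open>Some\<close>.\<close>
  define G where "G k z = (let v = machine (list_of (set_of k)) (fst z) in
    if Q (v @ invc (fst z)) then Suc (list_encode v) else 0)" for k and z :: "nat list \<times> nat"
  have fin: "finite (verts \<Gamma>)" using graph by (simp add: is_coxeter_graph_def)
  have inj: "inj_on ?code (Pow (verts \<Gamma>))"
  proof (rule inj_onI)
    fix T U assume a: "T \<in> Pow (verts \<Gamma>)" "U \<in> Pow (verts \<Gamma>)" "?code T = ?code U"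
    then have "finite (num ` T)" "finite (num ` U)" using fin by (auto intro: finite_subset)
    then have "num ` T = num ` U" using a(3) set_encode_eq by simp
    then show "T = U" using a inj_on_image_eq_iff[OF inj_num] by simp
  qed
  have set_of: "set_of (?code T) = T" if "T \<subseteq> verts \<Gamma>" for T
    unfolding set_of_def using inv_into_f_f[OF inj, of T] that by simp
  have list_of: "set (list_of T) = T" if "T \<subseteq> verts \<Gamma>" for T
    unfolding list_of_def using finite_list[OF finite_subset[OF that fin]] by (rule someI_ex)
  note fs = computable_fst[OF computable_ident] computable_snd[OF computable_ident]
  have G: "computable ?e id (G k)" for k
  proof -
    have v: "computable_list ?e (\<lambda>z. machine (list_of (set_of k)) (fst z))"
      by (rule computable_machine[OF fs(1)])
    have "computable ?e id (\<lambda>z. Suc (list_encode (machine (list_of (set_of k)) (fst z))))"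
      by (rule computable_comp[OF computable_list_encode[OF v] computable_Suc])
    then show ?thesis
      unfolding G_def[abs_def] Let_def
      by (intro computable_if computable_Q' computable_append v computable_invc fs
          computable_const)
  qed
  have "finite A" using fin by (simp add: A_def)
  have "computable ?e id (\<lambda>z. if snd z \<in> A then G (snd z) z else 0)"
    by (rule computable_finite_cases[OF \<open>finite A\<close> fs(2) G computable_const])
  then obtain f where f: "recursive 1 f"
    "\<And>z. f [?e z] = id (if snd z \<in> A then G (snd z) z else 0)"
    unfolding computable_on_def by blast
  show ?thesis
    unfolding computable_on_def
  proof (rule exI[of _ f], rule conjI[OF f(1)], rule ballI)
    fix z assume "z \<in> words (verts \<Gamma>) \<times> Pow (verts \<Gamma>)"
    then obtain w T where z: "z = (w, T)" "w \<in> words (verts \<Gamma>)" "T \<subseteq> verts \<Gamma>" by auto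
    have "word_subset_code num z = ?e (wc w, ?code T)"
      by (simp add: z word_subset_code_def word_code_def pair_code_def ltr_def)
    then have "f [word_subset_code num z] = G (?code T) (wc w, ?code T)"
      using f(2)[of "(wc w, ?code T)"] z(3) by (simp add: A_def)
    also have "\<dots> = (if Q (wc (out T [] w) @ invc (wc w)) then Suc (list_encode (wc (out T [] w))) else 0)"
      using machine_correct[OF list_of[OF z(3)] z(3,2)] by (simp add: G_def set_of[OF z(3)])
    also have "Q (wc (out T [] w) @ invc (wc w)) \<longleftrightarrow> (out T [] w, w) \<in> acong"
      using out_letters[of T "[]" w] z(2,3) by (intro Q_wc_inverse) (auto simp: words_iff_fst)
    finally show "f [word_subset_code num z] = word_option_code num (kappa z)"
      by (simp add: z(1) kappa_def word_option_code_def word_code_def ltr_def)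
  qed
qed

end

theorem proposition2p7:
  fixes \<Gamma> :: "'a coxeter_graph" and num :: "'a \<Rightarrow> nat"
  assumes "is_coxeter_graph \<Gamma>"
    and "inj_on num (verts \<Gamma>)"
    and "word_problem_solvable num \<Gamma>"
  shows "\<exists>F. computable_on (word_subset_code num) (words (verts \<Gamma>) \<times> Pow (verts \<Gamma>))
               (word_option_code num) F \<and>
             (\<forall>\<alpha> \<in> carrier (artin_group \<Gamma>). \<forall>\<omega> \<in> words (verts \<Gamma>). \<forall>T \<subseteq> verts \<Gamma>.
                represents \<Gamma> \<omega> \<alpha> \<longrightarrow>
                (case F (\<omega>, T) of
                   None \<Rightarrow> \<alpha> \<notin> standard_parabolic \<Gamma> T
                 | Some \<kappa> \<Rightarrow> \<alpha> \<in> standard_parabolic \<Gamma> T \<and> \<kappa> \<in> words T \<and> represents \<Gamma> \<kappa> \<alpha>))"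
proof -
  interpret artin \<Gamma> by unfold_locales (rule assms(1))
  obtain f where f: "recursive 1 f"
    "\<forall>w\<in>words (verts \<Gamma>). f [word_code num w] = of_bool (represents \<Gamma> w \<one>\<^bsub>artin_group \<Gamma>\<^esub>)"
    using assms(3) unfolding word_problem_solvable_def decidable_on_def computable_on_def by blast
  \<comment> \<open>Off codes of words \<open>f\<close> may return any number; comparison with 1
    still gives a predicate on all lists.\<close>
  define Q where "Q l \<longleftrightarrow> f [list_encode l] = 1" for l
  interpret artin_oracle \<Gamma> num Q
  proof
    show "inj_on num (verts \<Gamma>)" by (rule assms(2))
    have "computable list_encode id (\<lambda>l. f [list_encode l])"
      by (rule computableI[OF f(1)]) simp
    then show "computable list_encode of_bool Q"
      unfolding Q_def[abs_def] by (rule computable_eq_const)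
    fix w assume w: "w \<in> words (verts \<Gamma>)"
    then have "f [word_code num w] = of_bool ((w, []) \<in> acong)"
      using f(2) represents_iff[OF w] cls_eq_iff[OF w, of "[]"] pres_cong.sym
      by (auto simp: one_artin)
    then show "Q (map (\<lambda>(s, b). 2 * num s + of_bool b) w) \<longleftrightarrow> (w, []) \<in> acong"
      by (simp add: Q_def word_code_def)
  qed
  show ?thesis
  proof (rule exI[of _ kappa], rule conjI[OF computable_kappa], intro ballI allI impI)
    fix \<alpha> \<omega> T
    assume w: "\<omega> \<in> words (verts \<Gamma>)" and T: "T \<subseteq> verts \<Gamma>" and "represents \<Gamma> \<omega> \<alpha>"
    then have \<alpha>: "\<alpha> = cls \<omega>" using represents_iff by blast
    have o: "out T [] \<omega> \<in> words T" using out_letters[of T "[]" \<omega>] by (simp add: words_iff_fst)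
    then have o': "out T [] \<omega> \<in> words (verts \<Gamma>)" using T by (auto simp: words_iff_fst)
    show "case kappa (\<omega>, T) of None \<Rightarrow> \<alpha> \<notin> standard_parabolic \<Gamma> T
        | Some \<kappa> \<Rightarrow> \<alpha> \<in> standard_parabolic \<Gamma> T \<and> \<kappa> \<in> words T \<and> represents \<Gamma> \<kappa> \<alpha>"
    proof (cases "(out T [] \<omega>, \<omega>) \<in> acong")
      case True
      then have "cls \<omega> = cls (out T [] \<omega>)" using cls_eq_iff[OF o' w] by simp
      then show ?thesis
        using True mem_parabolic_iff[OF T w] o represents_iff[OF o'] by (simp add: kappa_def \<alpha>)
    next
      case False
      then show ?thesis using mem_parabolic_iff[OF T w] by (simp add: kappa_def \<alpha>)
    qed
  qed
qed

end
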